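(* Let $(M,\mathcal{H},\mathbf{h})$ be a sub-Riemannian manifold and let $\mathbf{g}$ be a Riemannian metric on $M$ taming $\mathbf{h}$, i.e. $\mathbf{g}|_{\mathcal{H}}=\mathbf{h}$. Let $\mathcal{V}$ be the $\mathbf{g}$-orthogonal complement of $\mathcal{H}$ in $TM$, let $\mathbf{v}=\mathbf{g}|_{\mathcal{V}}$, let $H^{\mathbf{h}}$, $H^{\mathbf{v}}$ and $H^{\mathbf{g}}=H^{\mathbf{h}}+H^{\mathbf{v}}$ be the associated Hamiltonian functions on $T^*M$, and let $\mathring{\nabla}$ be the affine connection on $M$ defined in the context. Let $\{\cdot,\cdot\}$ denote the Poisson bracket with respect to the canonical symplectic form on $T^*M$. Then $$\{H^{\mathbf{h}},H^{\mathbf{v}}\}=\{H^{\mathbf{h}},H^{\mathbf{g}}\}=0 \quad\text{if and only if}\quad \mathring{\nabla}\mathbf{g}=0.$$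
   Context: All manifolds are smooth and connected. A sub-Riemannian manifold $(M,\mathcal{H},\mathbf{h})$ consists of a connected manifold $M$, a subbundle $\mathcal{H}\subseteq TM$, and a (smooth, positive definite) metric tensor $\mathbf{h}$ defined only on $\mathcal{H}$. (No bracket-generating assumption on $\mathcal{H}$ and no integrability assumption on $\mathcal{V}$ is made.) Cometrics: given a subbundle $\mathcal{E}\subseteq TM$ with a metric tensor $\mathbf{s}$ on $\mathcal{E}$, the associated (possibly degenerate) cometric $\mathbf{s}^*$ is the unique symmetric positive semidefinite bilinear tensor on $T^*M$ such that the map $\sharp^{\mathbf{s}^*}:T^*M\to TM$, $p\mapsto \mathbf{s}^*(p,\cdot)$, has image $\mathcal{E}$ and $\mathbf{s}(\sharp^{\mathbf{s}^*}p_1,\sharp^{\mathbf{s}^*}p_2)=\mathbf{s}^*(p_1,p_2)$ for all $p_1,p_2\in T^*_xM$, $x\in M$. Applying this to $(\mathcal{H},\mathbf{h})$ and $(\mathcal{V},\mathbf{v})$ gives cometrics $\mathbf{h}^*$ and $\mathbf{v}^*$, and one sets $$H^{\mathbf{h}}(p)=\tfrac12\mathbf{h}^*(p,p),\qquad H^{\mathbf{v}}(p)=\tfrac12\mathbf{v}^*(p,p),\qquad H^{\mathbf{g}}=H^{\mathbf{h}}+H^{\mathbf{v}},\qquad p\in T^*M;$$ $H^{\mathbf{g}}$ is the Hamiltonian of the Riemannian metric $\mathbf{g}$. Let $\nabla^{\mathbf{g}}$ be the Levi-Civita connection of $\mathbf{g}$ and let $\mathrm{pr}_{\mathcal{H}}$,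 $\mathrm{pr}_{\mathcal{V}}$ be the $\mathbf{g}$-orthogonal projections onto $\mathcal{H}$ and $\mathcal{V}$. The connection $\mathring{\nabla}$ is defined, for vector fields $X,Y$ on $M$, by $$\mathring{\nabla}_XY=\mathrm{pr}_{\mathcal{H}}\nabla^{\mathbf{g}}_{\mathrm{pr}_{\mathcal{H}}X}\mathrm{pr}_{\mathcal{H}}Y+\mathrm{pr}_{\mathcal{V}}\nabla^{\mathbf{g}}_{\mathrm{pr}_{\mathcal{V}}X}\mathrm{pr}_{\mathcal{V}}Y+\mathrm{pr}_{\mathcal{H}}[\mathrm{pr}_{\mathcal{V}}X,\mathrm{pr}_{\mathcal{H}}Y]+\mathrm{pr}_{\mathcal{V}}[\mathrm{pr}_{\mathcal{H}}X,\mathrm{pr}_{\mathcal{V}}Y].$$ *)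

theory Defs
  imports "HOL-Analysis.Analysis"
begin

section \<open>Smooth maps between normed spaces\<close>

text \<open>Only used for open sets \<open>S\<close> of a finite-dimensional space, where requiring iterated
  directional derivatives in all constant directions is the usual $C^k$ condition.\<close>

primrec Ck_on :: "nat \<Rightarrow> 'a::real_normed_vector set \<Rightarrow> ('a \<Rightarrow> 'b::real_normed_vector) \<Rightarrow> bool" where
  "Ck_on 0 = (\<lambda>S f. continuous_on S f)"
| "Ck_on (Suc k) = (\<lambda>S f. (\<forall>x\<in>S. f differentiable (at x)) \<and>
      (\<forall>v. Ck_on k S (\<lambda>x. frechet_derivative f (at x) v)))"

definition smooth_on :: "'a::real_normed_vector set \<Rightarrow> ('a \<Rightarrow> 'b::real_normed_vector) \<Rightarrow> bool" where
  "smooth_on S f \<longleftrightarrow> (\<forall>k. Ck_on k S f)"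


section \<open>Smooth manifolds\<close>

text \<open>The manifold is the whole type \<open>'m\<close>, with smooth structure given by an atlas \<open>A\<close> of charts into
  the model space \<open>'e\<close>. The Hausdorff and second countability axioms are type class constraints.\<close>

type_synonym ('m, 'e) chart = "'m set \<times> ('m \<Rightarrow> 'e)"

definition is_chart :: "('m::topological_space, 'e::euclidean_space) chart \<Rightarrow> bool" where
  "is_chart c \<longleftrightarrow> open (fst c) \<and> open (snd c ` fst c) \<and>
     homeomorphism (fst c) (snd c ` fst c) (snd c) (inv_into (fst c) (snd c))"

definition chart_inv :: "('m, 'e) chart \<Rightarrow> 'e \<Rightarrow> 'm" where
  "chart_inv c = inv_into (fst c) (snd c)"

definition transition :: "('m, 'e) chart \<Rightarrow> ('m, 'e) chart \<Rightarrow> 'e \<Rightarrow> 'e" where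
  "transition c d = snd d \<circ> chart_inv c"

definition smooth_manifold ::
    "('m::{t2_space,second_countable_topology}, 'e::euclidean_space) chart set \<Rightarrow> bool" where
  "smooth_manifold A \<longleftrightarrow> (\<forall>c\<in>A. is_chart c) \<and> (\<Union>c\<in>A. fst c) = UNIV \<and>
     (\<forall>c\<in>A. \<forall>d\<in>A. smooth_on (snd c ` (fst c \<inter> fst d)) (transition c d))"

definition chart_at :: "('m, 'e) chart set \<Rightarrow> 'm \<Rightarrow> ('m, 'e) chart" where
  "chart_at A x = (SOME c. c \<in> A \<and> x \<in> fst c)"

definition smooth_fun_on :: "('m, 'e::euclidean_space) chart set \<Rightarrow> 'm set \<Rightarrow> ('m \<Rightarrow> real) \<Rightarrow> bool" where
  "smooth_fun_on A U f \<longleftrightarrow> (\<forall>c\<in>A. smooth_on (snd c ` (fst c \<inter> U)) (f \<circ> chart_inv c))"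


section \<open>Tangent and cotangent vectors\<close>

text \<open>Every tangent space $T_xM$ is represented by the model space \<open>'e\<close>: the vector \<open>v\<close> at the
  point \<open>x\<close> stands for the tangent vector whose coordinates in the chosen chart \<open>chart_at A x\<close> are
  \<open>v\<close>. Correspondingly $T_x^*M$ is represented by the dual space \<open>'e \<Rightarrow>\<^sub>L real\<close>, and $T^*M$
  by \<open>'m \<times> ('e \<Rightarrow>\<^sub>L real)\<close>. As \<open>chart_at A x\<close> depends on \<open>x\<close> in an arbitrary way, nothing may be
  differentiated in \<open>x\<close> before it has been transported to one fixed chart, which is what
  \<open>tangent_coord\<close> and \<open>field_in_chart\<close> (vectors) and \<open>cotangent_chart_inv\<close> (covectors) do.\<close>

definition tangent_coord ::
    "('m, 'e::euclidean_space) chart set \<Rightarrow> ('m, 'e) chart \<Rightarrow> 'm \<Rightarrow> 'e \<Rightarrow> 'e" where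
  "tangent_coord A c x v =
     frechet_derivative (transition (chart_at A x) c) (at (snd (chart_at A x) x)) v"

definition field_in_chart ::
    "('m, 'e::euclidean_space) chart set \<Rightarrow> ('m, 'e) chart \<Rightarrow> ('m \<Rightarrow> 'e) \<Rightarrow> 'e \<Rightarrow> 'e" where
  "field_in_chart A c X q = tangent_coord A c (chart_inv c q) (X (chart_inv c q))"

definition smooth_field_on ::
    "('m, 'e::euclidean_space) chart set \<Rightarrow> 'm set \<Rightarrow> ('m \<Rightarrow> 'e) \<Rightarrow> bool" where
  "smooth_field_on A U X \<longleftrightarrow> (\<forall>c\<in>A. smooth_on (snd c ` (fst c \<inter> U)) (field_in_chart A c X))"

definition vector_field :: "('m, 'e::euclidean_space) chart set \<Rightarrow> ('m \<Rightarrow> 'e) \<Rightarrow> bool" where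
  "vector_field A X \<longleftrightarrow> smooth_field_on A UNIV X"

text \<open>The derivative $Xf$ of a function along a vector field.\<close>

definition field_deriv ::
    "('m, 'e::euclidean_space) chart set \<Rightarrow> ('m \<Rightarrow> 'e) \<Rightarrow> ('m \<Rightarrow> real) \<Rightarrow> 'm \<Rightarrow> real" where
  "field_deriv A X f x =
     frechet_derivative (f \<circ> chart_inv (chart_at A x)) (at (snd (chart_at A x) x)) (X x)"

text \<open>In coordinates $[X,Y]^i = \sum_j (X^j \partial_j Y^i - Y^j \partial_j X^i)$. In the chart
  \<open>chart_at A x\<close> itself the coordinates at \<open>x\<close> of \<open>X\<close> and \<open>Y\<close> are \<open>X x\<close> and \<open>Y x\<close>.\<close>

definition lie_bracket ::
    "('m, 'e::euclidean_space) chart set \<Rightarrow> ('m \<Rightarrow> 'e) \<Rightarrow> ('m \<Rightarrow> 'e) \<Rightarrow> 'm \<Rightarrow> 'e" where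
  "lie_bracket A X Y x = (let c = chart_at A x; q = snd c x in
     frechet_derivative (field_in_chart A c Y) (at q) (X x) -
     frechet_derivative (field_in_chart A c X) (at q) (Y x))"


section \<open>Subbundles and metric tensors\<close>

definition subbundle :: "('m::topological_space, 'e::euclidean_space) chart set \<Rightarrow> ('m \<Rightarrow> 'e set) \<Rightarrow> bool" where
  "subbundle A E \<longleftrightarrow> (\<forall>x. \<exists>U k (B :: nat \<Rightarrow> 'm \<Rightarrow> 'e). open U \<and> x \<in> U \<and>
     (\<forall>i<k. smooth_field_on A U (B i)) \<and>
     (\<forall>y\<in>U. E y = span ((\<lambda>i. B i y) ` {..<k}) \<and> dim (E y) = k))"

text \<open>A metric tensor on a subbundle \<open>E\<close>; the values of \<open>s x\<close> outside \<open>E x\<close> are irrelevant.\<close>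

definition metric_tensor_on ::
    "('m::topological_space, 'e::euclidean_space) chart set \<Rightarrow> ('m \<Rightarrow> 'e set) \<Rightarrow> ('m \<Rightarrow> 'e \<Rightarrow> 'e \<Rightarrow> real) \<Rightarrow> bool" where
  "metric_tensor_on A E s \<longleftrightarrow>
     (\<forall>x. \<forall>u\<in>E x. \<forall>v\<in>E x. \<forall>w\<in>E x. \<forall>a b. s x (a *\<^sub>R u + b *\<^sub>R v) w = a * s x u w + b * s x v w) \<and>
     (\<forall>x. \<forall>u\<in>E x. \<forall>v\<in>E x. s x u v = s x v u) \<and>
     (\<forall>x. \<forall>u\<in>E x. u \<noteq> 0 \<longrightarrow> s x u u > 0) \<and>
     (\<forall>U X Y. open U \<and> smooth_field_on A U X \<and> smooth_field_on A U Y \<and>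
        (\<forall>x\<in>U. X x \<in> E x \<and> Y x \<in> E x) \<longrightarrow> smooth_fun_on A U (\<lambda>x. s x (X x) (Y x)))"

definition riemannian_metric ::
    "('m::topological_space, 'e::euclidean_space) chart set \<Rightarrow> ('m \<Rightarrow> 'e \<Rightarrow> 'e \<Rightarrow> real) \<Rightarrow> bool" where
  "riemannian_metric A g \<longleftrightarrow> metric_tensor_on A (\<lambda>x. UNIV) g"

definition sub_riemannian_manifold ::
    "('m::{t2_space,second_countable_topology}, 'e::euclidean_space) chart set \<Rightarrow>
     ('m \<Rightarrow> 'e set) \<Rightarrow> ('m \<Rightarrow> 'e \<Rightarrow> 'e \<Rightarrow> real) \<Rightarrow> bool" where
  "sub_riemannian_manifold A H h \<longleftrightarrow>
     smooth_manifold A \<and> connected (UNIV :: 'm set) \<and> subbundle A H \<and> metric_tensor_on A H h"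

definition tames ::
    "('m \<Rightarrow> 'e \<Rightarrow> 'e \<Rightarrow> real) \<Rightarrow> ('m \<Rightarrow> 'e set) \<Rightarrow> ('m \<Rightarrow> 'e \<Rightarrow> 'e \<Rightarrow> real) \<Rightarrow> bool" where
  "tames g H h \<longleftrightarrow> (\<forall>x. \<forall>u\<in>H x. \<forall>v\<in>H x. g x u v = h x u v)"

definition orth_complement ::
    "('m \<Rightarrow> 'e \<Rightarrow> 'e \<Rightarrow> real) \<Rightarrow> ('m \<Rightarrow> 'e set) \<Rightarrow> 'm \<Rightarrow> 'e set" where
  "orth_complement g H x = {v. \<forall>u\<in>H x. g x u v = 0}"

text \<open>The \<open>g\<close>-orthogonal projection of a vector field to the subbundle \<open>E\<close>.\<close>

definition pr ::
    "('m \<Rightarrow> 'e::euclidean_space \<Rightarrow> 'e \<Rightarrow> real) \<Rightarrow> ('m \<Rightarrow> 'e set) \<Rightarrow> ('m \<Rightarrow> 'e) \<Rightarrow> 'm \<Rightarrow> 'e" where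
  "pr g E X x = (THE u. u \<in> E x \<and> (\<forall>w\<in>E x. g x (X x - u) w = 0))"


section \<open>Cometrics and Hamiltonian functions\<close>

text \<open>The map $p \mapsto \sigma(p,\cdot)$, with values in $T_xM$ through $T_x^{**}M = T_xM$.\<close>

definition sharp ::
    "(('e::euclidean_space \<Rightarrow>\<^sub>L real) \<Rightarrow> ('e \<Rightarrow>\<^sub>L real) \<Rightarrow> real) \<Rightarrow> ('e \<Rightarrow>\<^sub>L real) \<Rightarrow> 'e" where
  "sharp \<sigma> p = (THE v. \<forall>q. blinfun_apply q v = \<sigma> p q)"

definition cometric ::
    "('m \<Rightarrow> 'e::euclidean_space set) \<Rightarrow> ('m \<Rightarrow> 'e \<Rightarrow> 'e \<Rightarrow> real) \<Rightarrow>
     'm \<Rightarrow> ('e \<Rightarrow>\<^sub>L real) \<Rightarrow> ('e \<Rightarrow>\<^sub>L real) \<Rightarrow> real" where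
  "cometric E s x = (THE \<sigma>. bilinear \<sigma> \<and> (\<forall>p q. \<sigma> p q = \<sigma> q p) \<and> (\<forall>p. \<sigma> p p \<ge> 0) \<and>
     range (sharp \<sigma>) = E x \<and> (\<forall>p q. s x (sharp \<sigma> p) (sharp \<sigma> q) = \<sigma> p q))"

definition hamiltonian ::
    "('m \<Rightarrow> 'e::euclidean_space set) \<Rightarrow> ('m \<Rightarrow> 'e \<Rightarrow> 'e \<Rightarrow> real) \<Rightarrow> 'm \<times> ('e \<Rightarrow>\<^sub>L real) \<Rightarrow> real" where
  "hamiltonian E s = (\<lambda>(x, p). 1/2 * cometric E s x p p)"


section \<open>The canonical symplectic form and the Poisson bracket\<close>

text \<open>A chart \<open>c\<close> of the manifold induces a chart of $T^*M$ with values in \<open>'e \<times> ('e \<Rightarrow>\<^sub>L real)\<close>; this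
  is its inverse. The covector at \<open>y\<close> with coordinates \<open>\<alpha>\<close> in the chart \<open>c\<close> maps a tangent vector
  \<open>v\<close> to the value of \<open>\<alpha>\<close> on the coordinates of \<open>v\<close> in \<open>c\<close>.\<close>

definition cotangent_chart_inv ::
    "('m, 'e::euclidean_space) chart set \<Rightarrow> ('m, 'e) chart \<Rightarrow> 'e \<times> ('e \<Rightarrow>\<^sub>L real) \<Rightarrow> 'm \<times> ('e \<Rightarrow>\<^sub>L real)" where
  "cotangent_chart_inv A c = (\<lambda>(q, \<alpha>). let y = chart_inv c q in
     (y, \<alpha> o\<^sub>L Blinfun (tangent_coord A c y)))"

text \<open>The Liouville form $\theta_{(q,\alpha)}(u,\beta) = \alpha(u)$ in a chart of $T^*M$, and the
  canonical symplectic form $\omega = -d\theta$.\<close>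

definition liouville_form ::
    "'e::euclidean_space \<times> ('e \<Rightarrow>\<^sub>L real) \<Rightarrow> 'e \<times> ('e \<Rightarrow>\<^sub>L real) \<Rightarrow> real" where
  "liouville_form z \<xi> = blinfun_apply (snd z) (fst \<xi>)"

definition canonical_symplectic ::
    "'e::euclidean_space \<times> ('e \<Rightarrow>\<^sub>L real) \<Rightarrow> 'e \<times> ('e \<Rightarrow>\<^sub>L real) \<Rightarrow> 'e \<times> ('e \<Rightarrow>\<^sub>L real) \<Rightarrow> real" where
  "canonical_symplectic z \<xi> \<eta> =
     - (frechet_derivative (\<lambda>z. liouville_form z \<eta>) (at z) \<xi> -
        frechet_derivative (\<lambda>z. liouville_form z \<xi>) (at z) \<eta>)"

lemma canonical_symplectic_eq:
  "canonical_symplectic z (u, \<alpha>) (v, \<beta>) = blinfun_apply \<beta> u - blinfun_apply \<alpha> v"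
proof -
  have "frechet_derivative (\<lambda>z. liouville_form z \<eta>) (at z) = (\<lambda>\<xi>. blinfun_apply (snd \<xi>) (fst \<eta>))"
    for \<eta> z :: "'a \<times> ('a \<Rightarrow>\<^sub>L real)"
    unfolding liouville_form_def
    by (rule frechet_derivative_at[symmetric]) (auto intro!: derivative_eq_intros)
  then show ?thesis
    by (simp add: canonical_symplectic_def)
qed

definition hamiltonian_vector_field ::
    "('e::euclidean_space \<times> ('e \<Rightarrow>\<^sub>L real) \<Rightarrow> real) \<Rightarrow> 'e \<times> ('e \<Rightarrow>\<^sub>L real) \<Rightarrow> 'e \<times> ('e \<Rightarrow>\<^sub>L real)" where
  "hamiltonian_vector_field F z =
     (THE \<xi>. \<forall>\<eta>. canonical_symplectic z \<xi> \<eta> = frechet_derivative F (at z) \<eta>)"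

text \<open>At $(x,p)$ we use the chart of $T^*M$ induced by \<open>chart_at A x\<close>, in which $(x,p)$ has
  second coordinate \<open>p\<close>.\<close>

definition poisson_bracket ::
    "('m, 'e::euclidean_space) chart set \<Rightarrow> ('m \<times> ('e \<Rightarrow>\<^sub>L real) \<Rightarrow> real) \<Rightarrow>
     ('m \<times> ('e \<Rightarrow>\<^sub>L real) \<Rightarrow> real) \<Rightarrow> 'm \<times> ('e \<Rightarrow>\<^sub>L real) \<Rightarrow> real" where
  "poisson_bracket A F G = (\<lambda>(x, p). let c = chart_at A x; z = (snd c x, p) in
     canonical_symplectic z
       (hamiltonian_vector_field (F \<circ> cotangent_chart_inv A c) z)
       (hamiltonian_vector_field (G \<circ> cotangent_chart_inv A c) z))"


section \<open>Connections\<close>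

text \<open>Connections act on smooth vector fields on the whole manifold; their values on arguments that
  are not smooth are unconstrained.\<close>

definition affine_connection ::
    "('m, 'e::euclidean_space) chart set \<Rightarrow> (('m \<Rightarrow> 'e) \<Rightarrow> ('m \<Rightarrow> 'e) \<Rightarrow> 'm \<Rightarrow> 'e) \<Rightarrow> bool" where
  "affine_connection A D \<longleftrightarrow>
     (\<forall>X Y. vector_field A X \<and> vector_field A Y \<longrightarrow> vector_field A (D X Y)) \<and>
     (\<forall>X X' Y. vector_field A X \<and> vector_field A X' \<and> vector_field A Y \<longrightarrow>
        (\<forall>x. D (\<lambda>x. X x + X' x) Y x = D X Y x + D X' Y x)) \<and>
     (\<forall>f X Y. smooth_fun_on A UNIV f \<and> vector_field A X \<and> vector_field A Y \<longrightarrow>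
        (\<forall>x. D (\<lambda>x. f x *\<^sub>R X x) Y x = f x *\<^sub>R D X Y x)) \<and>
     (\<forall>X Y Y'. vector_field A X \<and> vector_field A Y \<and> vector_field A Y' \<longrightarrow>
        (\<forall>x. D X (\<lambda>x. Y x + Y' x) x = D X Y x + D X Y' x)) \<and>
     (\<forall>f X Y. smooth_fun_on A UNIV f \<and> vector_field A X \<and> vector_field A Y \<longrightarrow>
        (\<forall>x. D X (\<lambda>x. f x *\<^sub>R Y x) x = field_deriv A X f x *\<^sub>R Y x + f x *\<^sub>R D X Y x))"

definition torsion_free ::
    "('m, 'e::euclidean_space) chart set \<Rightarrow> (('m \<Rightarrow> 'e) \<Rightarrow> ('m \<Rightarrow> 'e) \<Rightarrow> 'm \<Rightarrow> 'e) \<Rightarrow> bool" where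
  "torsion_free A D \<longleftrightarrow> (\<forall>X Y. vector_field A X \<and> vector_field A Y \<longrightarrow>
     (\<forall>x. D X Y x - D Y X x - lie_bracket A X Y x = 0))"

text \<open>The covariant derivative $(\nabla_X g)(Y,Z)$ of a metric tensor.\<close>

definition metric_deriv ::
    "('m, 'e::euclidean_space) chart set \<Rightarrow> (('m \<Rightarrow> 'e) \<Rightarrow> ('m \<Rightarrow> 'e) \<Rightarrow> 'm \<Rightarrow> 'e) \<Rightarrow>
     ('m \<Rightarrow> 'e \<Rightarrow> 'e \<Rightarrow> real) \<Rightarrow> ('m \<Rightarrow> 'e) \<Rightarrow> ('m \<Rightarrow> 'e) \<Rightarrow> ('m \<Rightarrow> 'e) \<Rightarrow> 'm \<Rightarrow> real" where
  "metric_deriv A D g X Y Z x =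
     field_deriv A X (\<lambda>x. g x (Y x) (Z x)) x - g x (D X Y x) (Z x) - g x (Y x) (D X Z x)"

definition parallel_metric ::
    "('m, 'e::euclidean_space) chart set \<Rightarrow> (('m \<Rightarrow> 'e) \<Rightarrow> ('m \<Rightarrow> 'e) \<Rightarrow> 'm \<Rightarrow> 'e) \<Rightarrow>
     ('m \<Rightarrow> 'e \<Rightarrow> 'e \<Rightarrow> real) \<Rightarrow> bool" where
  "parallel_metric A D g \<longleftrightarrow>
     (\<forall>X Y Z. vector_field A X \<and> vector_field A Y \<and> vector_field A Z \<longrightarrow>
        (\<forall>x. metric_deriv A D g X Y Z x = 0))"

definition levi_civita_connection ::
    "('m, 'e::euclidean_space) chart set \<Rightarrow> ('m \<Rightarrow> 'e \<Rightarrow> 'e \<Rightarrow> real) \<Rightarrow>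
     (('m \<Rightarrow> 'e) \<Rightarrow> ('m \<Rightarrow> 'e) \<Rightarrow> 'm \<Rightarrow> 'e) \<Rightarrow> bool" where
  "levi_civita_connection A g D \<longleftrightarrow>
     affine_connection A D \<and> parallel_metric A D g \<and> torsion_free A D"

text \<open>The connection $\mathring{\nabla}$ obtained from the Levi-Civita connection \<open>D\<close> of \<open>g\<close> and an
  orthogonal splitting of the tangent bundle into \<open>H\<close> and \<open>V\<close>.\<close>

definition ring_connection ::
    "('m, 'e::euclidean_space) chart set \<Rightarrow> ('m \<Rightarrow> 'e \<Rightarrow> 'e \<Rightarrow> real) \<Rightarrow> ('m \<Rightarrow> 'e set) \<Rightarrow> ('m \<Rightarrow> 'e set) \<Rightarrow>
     (('m \<Rightarrow> 'e) \<Rightarrow> ('m \<Rightarrow> 'e) \<Rightarrow> 'm \<Rightarrow> 'e) \<Rightarrow> ('m \<Rightarrow> 'e) \<Rightarrow> ('m \<Rightarrow> 'e) \<Rightarrow> 'm \<Rightarrow> 'e" where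
  "ring_connection A g H V D X Y x =
     pr g H (D (pr g H X) (pr g H Y)) x +
     pr g V (D (pr g V X) (pr g V Y)) x +
     pr g H (lie_bracket A (pr g V X) (pr g H Y)) x +
     pr g V (lie_bracket A (pr g H X) (pr g V Y)) x"

end

theory Submission
  imports Defs
begin

text \<open>
  Write \<open>X = X\<^sub>H + X\<^sub>V\<close> for the splitting of a vector field. As the Levi-Civita connection is metric,
  the derivative $(\mathring\nabla_X \mathbf{g})(Y,Z)$ equals
  $(L_{X_V} \mathbf{g})(Y_H,Z_H) + (L_{X_H} \mathbf{g})(Y_V,Z_V)$, so $\mathring\nabla\mathbf{g} = 0$ means that
  both mixed Lie derivatives vanish. On the other side, fix a covector $\alpha$ in a chart and let
  $U$, $W$ be the local sections of \<open>H\<close> and \<open>V\<close> dual to the constant form $\alpha$. Then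
  $H^{\mathbf{h}} = \frac12 \alpha(U)$ and $H^{\mathbf{v}} = \frac12 \alpha(W)$ at $\alpha$, whence
  $2\{H^{\mathbf{h}},H^{\mathbf{v}}\}(\alpha) = -\alpha([U,W]) = (L_U \mathbf{g})(W,W) - (L_W \mathbf{g})(U,U)$.
  The mixed Lie derivatives are tensorial, so scaling $U$ separates the two terms, and
  polarization and globally defined extensions of tangent vectors connect the two conditions.
\<close>

section \<open>Calculus of $C^k$ maps\<close>

text \<open>The obstacle is a mismatch of domains. The bracket at a covector involves the dual
  sections of \<open>H\<close> and \<open>V\<close>, which are available only as germs in
  \<open>chart_at A x\<close>, whereas \<open>parallel_metric\<close> tests only fields defined on
  the whole manifold. A tangent vector is therefore extended by a bump function and projected to
  \<open>H\<close> or \<open>V\<close>; the resulting field agrees with the dual section at the base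
  point, but not to first order. This is enough because differentiating g(U,Z) = 0, with Z a section
  of the other subbundle, expresses g(dU,Z) through the values of U and the derivatives of Z and g.
  So L_U g on that subbundle does not depend on how U continues away from the point. The 2 in front
  of the bracket comes from the Hamiltonian being quadratic in the covector: its fibre derivative is
  the full dual section, while its base derivative keeps the factor 1/2. Differentiability of the
  dual sections comes from local orthogonal frames of \<open>H\<close> and of the tangent bundle;
  the dual section of \<open>V\<close> is the difference of the other two.\<close>

lemma Ck_on_cong:
  assumes "open S" "\<And>x. x \<in> S \<Longrightarrow> f x = g x" "Ck_on k S f"
  shows "Ck_on k S g"
  using assms(2,3)
proof (induction k arbitrary: f g)
  case 0
  then show ?case using continuous_on_cong[of S S f g] by simp
next
  case (Suc k)
  have d: "(g has_derivative frechet_derivative f (at x)) (at x)" if "x \<in> S" for x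
    by (rule has_derivative_transform_within_open[of f _ x UNIV S])
       (use Suc.prems that assms(1) in \<open>auto simp: frechet_derivative_works\<close>)
  have e: "frechet_derivative f (at x) v = frechet_derivative g (at x) v" if "x \<in> S" for x v
    using frechet_derivative_at[OF d[OF that]] by simp
  have "Ck_on k S (\<lambda>x. frechet_derivative g (at x) v)" for v
    by (rule Suc.IH[OF e]) (use Suc.prems in auto)
  then show ?case
    using d by (auto simp: differentiable_def)
qed

lemma Ck_on_subset: "Ck_on k S f \<Longrightarrow> T \<subseteq> S \<Longrightarrow> Ck_on k T f"
  by (induction k arbitrary: f) (auto intro: continuous_on_subset)

lemma Ck_on_local:
  assumes "\<And>x. x \<in> S \<Longrightarrow> \<exists>T. open T \<and> x \<in> T \<and> Ck_on k T f"
  shows "Ck_on k S f"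
  using assms
proof (induction k arbitrary: f)
  case 0
  show ?case
    unfolding Ck_on.simps continuous_on_eq_continuous_within
  proof
    fix x assume "x \<in> S"
    then obtain T where "open T" "x \<in> T" "continuous_on T f"
      using 0 by force
    then have "isCont f x" by (simp add: continuous_on_eq_continuous_at)
    then show "continuous (at x within S) f"
      by (rule continuous_at_imp_continuous_at_within)
  qed
next
  case (Suc k)
  have "f differentiable (at x)" if "x \<in> S" for x
    using Suc.prems[OF that] by auto
  moreover have "Ck_on k S (\<lambda>x. frechet_derivative f (at x) v)" for v
    by (rule Suc.IH) (use Suc.prems in force)
  ultimately show ?case by simp
qed

lemma Ck_on_const: "Ck_on k S (\<lambda>x. c)"
  by (induction k arbitrary: c) (simp_all add: frechet_derivative_const)

lemma Ck_on_bounded_linear: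
  assumes "bounded_linear f"
  shows "Ck_on k S f"
proof (cases k)
  case 0
  then show ?thesis by (simp add: linear_continuous_on assms)
next
  case (Suc j)
  have "frechet_derivative f (at x) = f" for x
    using frechet_derivative_at[OF bounded_linear_imp_has_derivative[OF assms]] by simp
  then show ?thesis
    using assms Suc bounded_linear_imp_differentiable by (auto simp: Ck_on_const)
qed

lemma Ck_on_Suc_D: "Ck_on (Suc k) S f \<Longrightarrow> Ck_on k S f"
proof (induction k arbitrary: f)
  case 0
  then show ?case
    by (auto simp: continuous_on_eq_continuous_within
        intro!: continuous_at_imp_continuous_at_within[OF differentiable_imp_continuous_within])
next
  case (Suc k)
  have "Ck_on k S (\<lambda>x. frechet_derivative f (at x) v)" for v
    by (rule Suc.IH) (use Suc.prems in simp)
  then show ?case using Suc.prems by simp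
qed

text \<open>Allows a derivative supplied by the calculus rules to stand in for
  \<open>frechet_derivative\<close>. Openness of \<open>S\<close> lets the pointwise equality of the
  two pass through \<open>Ck_on_cong\<close>.\<close>

lemma Ck_on_SucI:
  assumes "open S"
    and "\<And>x. x \<in> S \<Longrightarrow> (f has_derivative f' x) (at x)"
    and "\<And>v. Ck_on k S (\<lambda>x. f' x v)"
  shows "Ck_on (Suc k) S f"
proof -
  have "frechet_derivative f (at x) = f' x" if "x \<in> S" for x
    using frechet_derivative_at[OF assms(2)[OF that]] by simp
  then have "Ck_on k S (\<lambda>x. frechet_derivative f (at x) v)" for v
    by (intro Ck_on_cong[OF assms(1) _ assms(3)[of v]]) simp
  then show ?thesis
    using assms(2) by (auto simp: differentiable_def)
qed

lemma Ck_on_Suc_has_derivative: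
  "Ck_on (Suc k) S f \<Longrightarrow> x \<in> S \<Longrightarrow> (f has_derivative frechet_derivative f (at x)) (at x)"
  by (simp add: frechet_derivative_works)

lemma Ck_on_add:
  assumes "open S" "Ck_on k S f" "Ck_on k S g"
  shows "Ck_on k S (\<lambda>x. f x + g x)"
  using assms(2,3)
proof (induction k arbitrary: f g)
  case (Suc k)
  show ?case
    by (rule Ck_on_SucI[OF assms(1) has_derivative_add[OF Ck_on_Suc_has_derivative[OF Suc.prems(1)]
              Ck_on_Suc_has_derivative[OF Suc.prems(2)]]])
       (use Suc in auto)
qed (auto intro: continuous_on_add)

text \<open>One Leibniz rule serves products, scalar multiples and inner products. The derivative
  still contains the undifferentiated factors, so \<open>Ck_on_Suc_D\<close> lowers their order
  before the induction hypothesis applies.\<close>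

lemma Ck_on_bilinear:
  assumes "open S" "bounded_bilinear p" "Ck_on k S f" "Ck_on k S g"
  shows "Ck_on k S (\<lambda>x. p (f x) (g x))"
  using assms(3,4)
proof (induction k arbitrary: f g)
  case 0
  then show ?case using bounded_bilinear.continuous_on[OF assms(2)] by auto
next
  case (Suc k)
  show ?case
    by (rule Ck_on_SucI[OF assms(1) bounded_bilinear.FDERIV[OF assms(2)
          Ck_on_Suc_has_derivative[OF Suc.prems(1)] Ck_on_Suc_has_derivative[OF Suc.prems(2)]]])
       (use Suc.prems Ck_on_Suc_D[OF Suc.prems(1)] Ck_on_Suc_D[OF Suc.prems(2)] in
         \<open>auto intro!: Ck_on_add[OF assms(1)] Suc.IH\<close>)
qed

lemma Ck_on_inverse:
  fixes f :: "'a::real_normed_vector \<Rightarrow> real"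
  assumes "open S" "Ck_on k S f" "\<And>x. x \<in> S \<Longrightarrow> f x \<noteq> 0"
  shows "Ck_on k S (\<lambda>x. inverse (f x))"
  using assms(2)
proof (induction k)
  case 0
  then show ?case using assms(3) by (auto intro: continuous_on_inverse)
next
  case (Suc k)
  have IH: "Ck_on k S (\<lambda>x. inverse (f x))"
    using Suc Ck_on_Suc_D by blast
  have df: "Ck_on k S (\<lambda>x. (-1) * frechet_derivative f (at x) v)" for v
    using Suc.prems by (intro Ck_on_bilinear[OF assms(1) bounded_bilinear_mult Ck_on_const]) simp
  have "Ck_on k S (\<lambda>x. (inverse (f x) * ((-1) * frechet_derivative f (at x) v)) * inverse (f x))" for v
    by (intro Ck_on_bilinear[OF assms(1) bounded_bilinear_mult] IH df)
  then show ?case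
    by (intro Ck_on_SucI[OF assms(1) Deriv.has_derivative_inverse[OF assms(3) Ck_on_Suc_has_derivative[OF Suc.prems]]])
      (simp_all)
qed

lemma Ck_on_sum:
  assumes "open S" "\<And>i. i \<in> I \<Longrightarrow> Ck_on k S (f i)"
  shows "Ck_on k S (\<lambda>x. \<Sum>i\<in>I. f i x)"
  using assms(2)
  by (induction I rule: infinite_finite_induct) (auto intro: Ck_on_const Ck_on_add[OF assms(1)])

text \<open>In the chain rule the direction in which \<open>f\<close> is differentiated varies with
  the point, but \<open>Ck_on\<close> controls only constant directions. Expanding that direction
  over \<open>Basis\<close> reduces it to constant ones, which is why the domain of \<open>f\<close>
  is Euclidean.\<close>

lemma Ck_on_compose:
  fixes f :: "'a::euclidean_space \<Rightarrow> 'b::real_normed_vector"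
    and \<phi> :: "'c::real_normed_vector \<Rightarrow> 'a"
  assumes "open S" "\<phi> ` S \<subseteq> T" "Ck_on k S \<phi>" "Ck_on k T f"
  shows "Ck_on k S (\<lambda>x. f (\<phi> x))"
  using assms(3,4)
proof (induction k arbitrary: f)
  case 0
  then show ?case using assms(2) continuous_on_compose2[of T f S \<phi>] by auto
next
  case (Suc k)
  have eq: "frechet_derivative f (at (\<phi> x)) (frechet_derivative \<phi> (at x) v) =
      (\<Sum>b\<in>Basis. (frechet_derivative \<phi> (at x) v \<bullet> b) *\<^sub>R frechet_derivative f (at (\<phi> x)) b)" if "x \<in> S" for x v
  proof -
    have "linear (frechet_derivative f (at (\<phi> x)))"
      using Suc.prems(2) assms(2) that by (auto intro: linear_frechet_derivative)
    then have "frechet_derivative f (at (\<phi> x)) (\<Sum>b\<in>Basis. (frechet_derivative \<phi> (at x) v \<bullet> b) *\<^sub>R b) =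
      (\<Sum>b\<in>Basis. (frechet_derivative \<phi> (at x) v \<bullet> b) *\<^sub>R frechet_derivative f (at (\<phi> x)) b)"
      by (simp add: linear_sum linear_cmul)
    then show ?thesis by (simp add: euclidean_representation)
  qed
  have "Ck_on k S (\<lambda>x. \<Sum>b\<in>Basis. (frechet_derivative \<phi> (at x) v \<bullet> b) *\<^sub>R frechet_derivative f (at (\<phi> x)) b)" for v
    using Suc.prems Ck_on_Suc_D[OF Suc.prems(1)]
    by (auto intro!: Ck_on_sum[OF assms(1)] Ck_on_bilinear[OF assms(1) bounded_bilinear_scaleR]
        Ck_on_bilinear[OF assms(1) bounded_bilinear_inner] Ck_on_const Suc.IH)
  then have "Ck_on k S (\<lambda>x. frechet_derivative f (at (\<phi> x)) (frechet_derivative \<phi> (at x) v))" for v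
    by (rule Ck_on_cong[OF assms(1), rotated]) (simp add: eq)
  moreover have "((\<lambda>x. f (\<phi> x)) has_derivative (\<lambda>v. frechet_derivative f (at (\<phi> x)) (frechet_derivative \<phi> (at x) v))) (at x)"
    if "x \<in> S" for x
    by (rule has_derivative_compose[OF Ck_on_Suc_has_derivative[OF Suc.prems(1) that]
         Ck_on_Suc_has_derivative[OF Suc.prems(2)]]) (use that assms(2) in auto)
  ultimately show ?case
    by (rule Ck_on_SucI[OF assms(1), rotated])
qed

text \<open>The family \<open>exp (- 1 / t) / t ^ n\<close> is closed under differentiation up to linear combinations,
  so all its members are smooth by one simultaneous induction.\<close>

definition flat_exp :: "nat \<Rightarrow> real \<Rightarrow> real" where
  "flat_exp n t = (if t > 0 then exp (- inverse t) * inverse t ^ n else 0)"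

lemma flat_exp_deriv:
  "(flat_exp n has_real_derivative flat_exp (n + 2) t - real n * flat_exp (n + 1) t) (at t)"
proof -
  consider "t > 0" | "t < 0" | "t = 0" by linarith
  then show ?thesis
  proof cases
    case 1
    have i: "(inverse has_real_derivative - (inverse t * inverse t)) (at t)"
      using DERIV_inverse[of t] 1 by (simp add: power2_eq_square)
    have "((\<lambda>t. inverse t ^ n) has_real_derivative - (real n * inverse t ^ (n + 1))) (at t)"
    proof -
      have "real n * (- (inverse t * inverse t) * inverse t ^ (n - Suc 0)) = - (real n * inverse t ^ (n + 1))"
        by (cases n) (simp_all add: mult_ac)
      then show ?thesis using DERIV_power[OF i, of n] by metis
    qed
    moreover have "((\<lambda>t. exp (- inverse t)) has_real_derivative exp (- inverse t) * (inverse t * inverse t)) (at t)"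
      using DERIV_fun_exp[OF DERIV_minus[OF i]] by simp
    ultimately have "((\<lambda>t. exp (- inverse t) * inverse t ^ n) has_real_derivative
        exp (- inverse t) * (inverse t * inverse t) * inverse t ^ n +
        - (real n * inverse t ^ (n + 1)) * exp (- inverse t)) (at t)"
      by (rule DERIV_mult[rotated])
    then have "((\<lambda>t. exp (- inverse t) * inverse t ^ n) has_real_derivative
        flat_exp (n + 2) t - real n * flat_exp (n + 1) t) (at t)"
      using 1 by (simp add: flat_exp_def algebra_simps)
    then show ?thesis
      by (rule has_field_derivative_transform_within_open[of _ _ _ "{0<..}"]) (use 1 in \<open>auto simp: flat_exp_def\<close>)
  next
    case 2
    have "((\<lambda>t. 0) has_real_derivative 0) (at t)" by simp
    then have "(flat_exp n has_real_derivative 0) (at t)"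
      by (rule has_field_derivative_transform_within_open[of _ _ _ "{..<0}"]) (use 2 in \<open>auto simp: flat_exp_def\<close>)
    then show ?thesis using 2 by (simp add: flat_exp_def)
  next
    case 3
    \<comment> \<open>The difference quotient at 0 is s ^ (n + 1) / exp s with s = 1 / t, and the
      exponential wins as s tends to infinity.\<close>
    have "((\<lambda>t::real. (exp (- inverse t) * inverse t ^ n) / t) \<longlongrightarrow> 0) (at_right 0)"
    proof -
      have "((\<lambda>t::real. inverse t ^ Suc n / exp (inverse t)) \<longlongrightarrow> 0) (at_right 0)"
        by (rule filterlim_compose[OF tendsto_power_div_exp_0 filterlim_inverse_at_top_right])
      then show ?thesis by (simp add: exp_minus field_simps)
    qed
    then have "((\<lambda>t. flat_exp n t / t) \<longlongrightarrow> 0) (at_right 0)"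
      by (rule Lim_transform_eventually) (auto simp: eventually_at_filter flat_exp_def)
    moreover have "((\<lambda>t. flat_exp n t / t) \<longlongrightarrow> 0) (at_left 0)"
      by (rule tendsto_eventually) (auto simp: eventually_at_filter flat_exp_def)
    ultimately have "((\<lambda>t. flat_exp n t / t) \<longlongrightarrow> 0) (at 0)"
      by (simp add: filterlim_at_split)
    then show ?thesis using 3 by (simp add: has_field_derivative_iff flat_exp_def)
  qed
qed

lemma Ck_on_flat_exp: "Ck_on k UNIV (flat_exp n)"
proof (induction k arbitrary: n)
  case 0
  have "isCont (flat_exp n) t" for t
    using flat_exp_deriv DERIV_isCont by blast
  then show ?case by (simp add: continuous_on_eq_continuous_at)
next
  case (Suc k)
  have "Ck_on k UNIV (\<lambda>t. (flat_exp (n + 2) t + (- real n) * flat_exp (n + 1) t) * v)" for v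
    by (intro Ck_on_add Ck_on_bilinear[OF _ bounded_bilinear_mult] Ck_on_const Suc.IH) auto
  then show ?case
    using flat_exp_deriv[of n]
    by (intro Ck_on_SucI[of _ _ "\<lambda>t v. (flat_exp (n + 2) t - real n * flat_exp (n + 1) t) * v"])
       (auto simp: has_field_derivative_def)
qed

text \<open>The squared distance keeps the argument polynomial, hence smooth at the centre too. The
  value at the centre is positive but not 1.\<close>

definition bump :: "'a::euclidean_space \<Rightarrow> real \<Rightarrow> 'a \<Rightarrow> real" where
  "bump q r z = flat_exp 0 (r\<^sup>2 - (z - q) \<bullet> (z - q))"

lemma smooth_on_bump: "smooth_on UNIV (bump q r)"
  unfolding smooth_on_def
proof
  fix k
  have id: "Ck_on k UNIV (\<lambda>z::'a. z + (- q))"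
    by (intro Ck_on_add Ck_on_const Ck_on_bounded_linear bounded_linear_ident) auto
  have "Ck_on k UNIV (\<lambda>z. r\<^sup>2 + (-1) * ((z + (- q)) \<bullet> (z + (- q))))"
    by (intro Ck_on_add Ck_on_const Ck_on_bilinear[OF _ bounded_bilinear_mult]
        Ck_on_bilinear[OF _ bounded_bilinear_inner] id) auto
  then have "Ck_on k UNIV (\<lambda>z. flat_exp 0 (r\<^sup>2 + (-1) * ((z + (- q)) \<bullet> (z + (- q)))))"
    by (rule Ck_on_compose[OF open_UNIV subset_UNIV _ Ck_on_flat_exp])
  then show "Ck_on k UNIV (bump q r)"
    by (simp add: bump_def[abs_def])
qed

lemma bump_center: "r > 0 \<Longrightarrow> bump q r q > 0"
  by (simp add: bump_def flat_exp_def)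

lemma bump_eq_0:
  assumes "r > 0" "dist q z \<ge> r"
  shows "bump q r z = 0"
proof -
  have "r\<^sup>2 \<le> (z - q) \<bullet> (z - q)"
    using power_mono[OF assms(2), of 2] assms(1)
    by (simp add: dist_norm norm_minus_commute[of q z] power2_norm_eq_inner)
  then show ?thesis by (simp add: bump_def flat_exp_def)
qed

lemma smooth_on_cong: "open S \<Longrightarrow> (\<And>x. x \<in> S \<Longrightarrow> f x = g x) \<Longrightarrow> smooth_on S f \<Longrightarrow> smooth_on S g"
  unfolding smooth_on_def using Ck_on_cong by metis

lemma smooth_on_has_derivative:
  "smooth_on S f \<Longrightarrow> x \<in> S \<Longrightarrow> (f has_derivative frechet_derivative f (at x)) (at x)"
  unfolding smooth_on_def using Ck_on_Suc_has_derivative by blast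

section \<open>Smooth functions and fields on a manifold\<close>

locale smooth_atlas =
  fixes A :: "('m::{t2_space,second_countable_topology}, 'e::euclidean_space) chart set"
  assumes smooth_manifold: "smooth_manifold A"
begin

lemma chart_props:
  assumes "c \<in> A"
  shows "open (fst c)" "open (snd c ` fst c)"
    "homeomorphism (fst c) (snd c ` fst c) (snd c) (chart_inv c)"
  using smooth_manifold assms by (auto simp: smooth_manifold_def is_chart_def chart_inv_def)

lemma chart_inv_chart [simp]: "c \<in> A \<Longrightarrow> y \<in> fst c \<Longrightarrow> chart_inv c (snd c y) = y"
  using chart_props(3) by (auto simp: homeomorphism_def)

lemma chart_at_mem [simp]: "chart_at A x \<in> A" "x \<in> fst (chart_at A x)"
proof -
  have "x \<in> (\<Union>c\<in>A. fst c)"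
    using smooth_manifold by (simp add: smooth_manifold_def)
  then have "\<exists>c. c \<in> A \<and> x \<in> fst c" by blast
  then have "chart_at A x \<in> A \<and> x \<in> fst (chart_at A x)"
    unfolding chart_at_def by (rule someI_ex)
  then show "chart_at A x \<in> A" "x \<in> fst (chart_at A x)" by auto
qed

lemma open_chart_image:
  assumes "c \<in> A" "open U"
  shows "open (snd c ` (fst c \<inter> U))"
proof -
  have "openin (top_of_set (fst c)) (fst c \<inter> U)"
    using assms by auto
  then have "openin (top_of_set (snd c ` fst c)) (snd c ` (fst c \<inter> U))"
    by (rule homeomorphism_imp_open_map[OF chart_props(3)[OF assms(1)]])
  then show ?thesis
    using chart_props(2)[OF assms(1)] openin_open_trans by blast
qed

lemma eventually_chart_inv:
  assumes "c \<in> A" "open U" "x \<in> U" "x \<in> fst c"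
  shows "\<forall>\<^sub>F q in nhds (snd c x). chart_inv c q \<in> fst c \<inter> U \<and> snd c (chart_inv c q) = q"
  unfolding eventually_nhds
  using open_chart_image[OF assms(1,2)] assms
  by (intro exI[of _ "snd c ` (fst c \<inter> U)"]) auto

text \<open>Indexed by the point of the manifold instead of its coordinates, so that the chain rule
  becomes the cocycle identity \<open>jac_jac\<close>.\<close>

definition jac :: "('m, 'e) chart \<Rightarrow> ('m, 'e) chart \<Rightarrow> 'm \<Rightarrow> 'e \<Rightarrow> 'e" where
  "jac c d y = frechet_derivative (transition c d) (at (snd c y))"

lemma smooth_transition:
  "c \<in> A \<Longrightarrow> d \<in> A \<Longrightarrow> smooth_on (snd c ` (fst c \<inter> fst d)) (transition c d)"
  using smooth_manifold by (auto simp: smooth_manifold_def)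

lemma transition_has_derivative:
  assumes "c \<in> A" "d \<in> A" "y \<in> fst c" "y \<in> fst d"
  shows "(transition c d has_derivative jac c d y) (at (snd c y))"
  unfolding jac_def using assms
  by (intro smooth_on_has_derivative[OF smooth_transition]) auto

lemma transition_chart: "c \<in> A \<Longrightarrow> y \<in> fst c \<Longrightarrow> transition c d (snd c y) = snd d y"
  by (simp add: transition_def)

lemma jac_jac:
  assumes "c \<in> A" "d \<in> A" "e \<in> A" "y \<in> fst c" "y \<in> fst d" "y \<in> fst e"
  shows "jac d e y (jac c d y v) = jac c e y v"
proof -
  have "((\<lambda>q. transition d e (transition c d q)) has_derivative (\<lambda>v. jac d e y (jac c d y v))) (at (snd c y))"
    using assms transition_has_derivative transition_chart
    by (intro has_derivative_compose[OF transition_has_derivative]) auto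
  then have "(transition c e has_derivative (\<lambda>v. jac d e y (jac c d y v))) (at (snd c y))"
    by (rule has_derivative_transform_within_open[OF _ open_chart_image[OF assms(1) chart_props(1)[OF assms(2)]]])
       (use assms in \<open>auto simp: transition_def\<close>)
  from has_derivative_unique[OF this transition_has_derivative] show ?thesis
    using assms by (simp add: fun_eq_iff)
qed

lemma jac_same [simp]:
  assumes "c \<in> A" "y \<in> fst c"
  shows "jac c c y v = v"
proof -
  have "(transition c c has_derivative (\<lambda>v. v)) (at (snd c y))"
    by (rule has_derivative_transform_within_open[OF has_derivative_ident chart_props(2)[OF assms(1)]])
       (use assms in \<open>auto simp: transition_def\<close>)
  from has_derivative_unique[OF this transition_has_derivative] show ?thesis
    using assms by metis
qed

lemma linear_jac: "c \<in> A \<Longrightarrow> d \<in> A \<Longrightarrow> y \<in> fst c \<Longrightarrow> y \<in> fst d \<Longrightarrow> linear (jac c d y)"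
  using transition_has_derivative has_derivative_linear by blast

lemma tangent_coord_eq: "tangent_coord A c y = jac (chart_at A y) c y"
  by (simp add: tangent_coord_def jac_def fun_eq_iff)

lemma linear_tangent_coord: "c \<in> A \<Longrightarrow> y \<in> fst c \<Longrightarrow> linear (tangent_coord A c y)"
  by (simp add: tangent_coord_eq linear_jac)

text \<open>For fixed \<open>y\<close> in the domain of \<open>c\<close> this is the inverse of
  \<open>tangent_coord A c y\<close>; for fixed \<open>a\<close> it is the field with constant
  coordinates \<open>a\<close> in \<open>c\<close>.\<close>

definition coord_field :: "('m, 'e) chart \<Rightarrow> 'e \<Rightarrow> 'm \<Rightarrow> 'e" where
  "coord_field c a y = jac c (chart_at A y) y a"

lemma linear_coord_field: "c \<in> A \<Longrightarrow> y \<in> fst c \<Longrightarrow> linear (\<lambda>a. coord_field c a y)"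
  by (simp add: coord_field_def[abs_def] linear_jac)

lemma tangent_coord_coord_field:
  "c \<in> A \<Longrightarrow> d \<in> A \<Longrightarrow> y \<in> fst c \<Longrightarrow> y \<in> fst d \<Longrightarrow> tangent_coord A d y (coord_field c a y) = jac c d y a"
  by (simp add: tangent_coord_eq coord_field_def jac_jac)

lemma coord_field_tangent_coord [simp]:
  "c \<in> A \<Longrightarrow> y \<in> fst c \<Longrightarrow> coord_field c (tangent_coord A c y v) y = v"
  by (simp add: tangent_coord_eq coord_field_def jac_jac)

lemma tangent_coord_chart_at [simp]: "tangent_coord A (chart_at A x) x v = v"
  by (simp add: tangent_coord_eq)

lemma field_in_chart_chart_at [simp]: "field_in_chart A (chart_at A x) X (snd (chart_at A x) x) = X x"
  by (simp add: field_in_chart_def)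

text \<open>Seen in another chart \<open>d\<close>, the components are the derivative of the
  transition map in the constant direction \<open>a\<close>, composed with the reverse transition;
  both factors are smooth.\<close>

lemma smooth_field_on_coord_field:
  assumes "c \<in> A"
  shows "smooth_field_on A (fst c) (coord_field c a)"
  unfolding smooth_field_on_def
proof
  fix d assume d: "d \<in> A"
  let ?S = "snd d ` (fst d \<inter> fst c)"
  have S: "open ?S"
    using open_chart_image[OF d chart_props(1)[OF assms]] .
  have "Ck_on k ?S (\<lambda>q. frechet_derivative (transition c d) (at (transition d c q)) a)" for k
  proof (rule Ck_on_compose[where \<phi> = "transition d c" and f = "\<lambda>p. frechet_derivative (transition c d) (at p) a", OF S])
    show "transition d c ` ?S \<subseteq> snd c ` (fst c \<inter> fst d)"
      using d assms by (auto simp: transition_def)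
    show "Ck_on k ?S (transition d c)"
      using smooth_transition[OF d assms] by (auto simp: smooth_on_def)
    show "Ck_on k (snd c ` (fst c \<inter> fst d)) (\<lambda>p. frechet_derivative (transition c d) (at p) a)"
      using smooth_transition[OF assms d] unfolding smooth_on_def by (metis Ck_on.simps(2))
  qed
  then have "smooth_on ?S (\<lambda>q. frechet_derivative (transition c d) (at (transition d c q)) a)"
    by (simp add: smooth_on_def)
  then show "smooth_on ?S (field_in_chart A d (coord_field c a))"
    by (rule smooth_on_cong[OF S, rotated])
       (use d assms in \<open>auto simp: field_in_chart_def tangent_coord_coord_field jac_def transition_def\<close>)
qed

lemma smooth_field_on_subset: "smooth_field_on A U X \<Longrightarrow> W \<subseteq> U \<Longrightarrow> smooth_field_on A W X"
  unfolding smooth_field_on_def smooth_on_def by (blast intro: Ck_on_subset)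

lemma smooth_field_on_cong:
  assumes "open U" "\<And>y. y \<in> U \<Longrightarrow> X y = Y y" "smooth_field_on A U X"
  shows "smooth_field_on A U Y"
  unfolding smooth_field_on_def
proof
  fix c assume c: "c \<in> A"
  show "smooth_on (snd c ` (fst c \<inter> U)) (field_in_chart A c Y)"
    by (rule smooth_on_cong[OF open_chart_image[OF c assms(1)], of "field_in_chart A c X"])
       (use assms c in \<open>auto simp: smooth_field_on_def field_in_chart_def\<close>)
qed

lemma smooth_field_on_local:
  assumes "\<And>x. x \<in> U \<Longrightarrow> \<exists>W. open W \<and> x \<in> W \<and> smooth_field_on A W X"
  shows "smooth_field_on A U X"
  unfolding smooth_field_on_def smooth_on_def
proof (intro ballI allI Ck_on_local)
  fix c k q assume c: "c \<in> A" and "q \<in> snd c ` (fst c \<inter> U)"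
  then obtain x where x: "x \<in> fst c" "x \<in> U" "q = snd c x" by blast
  obtain W where "open W" "x \<in> W" "smooth_field_on A W X"
    using assms x by blast
  then show "\<exists>T. open T \<and> q \<in> T \<and> Ck_on k T (field_in_chart A c X)"
    using c x open_chart_image[OF c] unfolding smooth_field_on_def smooth_on_def by blast
qed

lemma smooth_field_on_0: "open U \<Longrightarrow> smooth_field_on A U (\<lambda>y. 0)"
  unfolding smooth_field_on_def
proof
  fix c assume "open U" and c: "c \<in> A"
  have "smooth_on (snd c ` (fst c \<inter> U)) (\<lambda>q. 0::'e)"
    by (simp add: smooth_on_def Ck_on_const)
  then show "smooth_on (snd c ` (fst c \<inter> U)) (field_in_chart A c (\<lambda>y. 0))"
    by (rule smooth_on_cong[OF open_chart_image[OF c \<open>open U\<close>], rotated])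
       (use c in \<open>auto simp: field_in_chart_def linear_0 linear_tangent_coord\<close>)
qed

lemma smooth_field_on_add:
  assumes "open U" "smooth_field_on A U X" "smooth_field_on A U Y"
  shows "smooth_field_on A U (\<lambda>y. X y + Y y)"
  unfolding smooth_field_on_def
proof
  fix c assume c: "c \<in> A"
  have "smooth_on (snd c ` (fst c \<inter> U)) (\<lambda>q. field_in_chart A c X q + field_in_chart A c Y q)"
    using assms c open_chart_image[OF c assms(1)]
    by (auto simp: smooth_on_def smooth_field_on_def intro!: Ck_on_add)
  then show "smooth_on (snd c ` (fst c \<inter> U)) (field_in_chart A c (\<lambda>y. X y + Y y))"
    by (rule smooth_on_cong[OF open_chart_image[OF c assms(1)], rotated])
       (use c in \<open>auto simp: field_in_chart_def linear_add linear_tangent_coord\<close>)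
qed

lemma smooth_field_on_scaleR:
  assumes "open U" "smooth_fun_on A U f" "smooth_field_on A U X"
  shows "smooth_field_on A U (\<lambda>y. f y *\<^sub>R X y)"
  unfolding smooth_field_on_def
proof
  fix c assume c: "c \<in> A"
  have "smooth_on (snd c ` (fst c \<inter> U)) (\<lambda>q. f (chart_inv c q) *\<^sub>R field_in_chart A c X q)"
    using assms c open_chart_image[OF c assms(1)]
    unfolding smooth_on_def smooth_field_on_def smooth_fun_on_def comp_def
    by (intro allI Ck_on_bilinear[OF _ bounded_bilinear_scaleR]) auto
  then show "smooth_on (snd c ` (fst c \<inter> U)) (field_in_chart A c (\<lambda>y. f y *\<^sub>R X y))"
    by (rule smooth_on_cong[OF open_chart_image[OF c assms(1)], rotated])
       (use c in \<open>auto simp: field_in_chart_def linear_cmul linear_tangent_coord\<close>)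
qed

lemma smooth_fun_on_const: "smooth_fun_on A U (\<lambda>y. r)"
  by (simp add: smooth_fun_on_def smooth_on_def comp_def Ck_on_const)

lemma smooth_fun_on_mult:
  assumes "open U" "smooth_fun_on A U f" "smooth_fun_on A U h"
  shows "smooth_fun_on A U (\<lambda>y. f y * h y)"
  using assms(2,3) open_chart_image[OF _ assms(1)]
  unfolding smooth_fun_on_def smooth_on_def
  by (auto simp: comp_def intro!: Ck_on_bilinear[OF _ bounded_bilinear_mult])

lemma smooth_fun_on_inverse:
  assumes "open U" "smooth_fun_on A U f" "\<And>y. y \<in> U \<Longrightarrow> f y \<noteq> 0"
  shows "smooth_fun_on A U (\<lambda>y. inverse (f y))"
  unfolding smooth_fun_on_def smooth_on_def comp_def
proof (intro ballI allI Ck_on_inverse)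
  fix c k q assume c: "c \<in> A"
  show "open (snd c ` (fst c \<inter> U))"
    using open_chart_image[OF c assms(1)] .
  show "Ck_on k (snd c ` (fst c \<inter> U)) (\<lambda>q. f (chart_inv c q))"
    using assms(2) c by (simp add: smooth_fun_on_def smooth_on_def comp_def)
  show "f (chart_inv c q) \<noteq> 0" if "q \<in> snd c ` (fst c \<inter> U)"
    using that c assms(3) by auto
qed

lemma smooth_field_on_diff:
  assumes "open U" "smooth_field_on A U X" "smooth_field_on A U Y"
  shows "smooth_field_on A U (\<lambda>y. X y - Y y)"
  using smooth_field_on_add[OF assms(1,2) smooth_field_on_scaleR[OF assms(1) smooth_fun_on_const[of _ "-1"] assms(3)]]
  by simp

lemma smooth_field_on_sum:
  assumes "open U" "\<And>i. i \<in> I \<Longrightarrow> smooth_field_on A U (X i)"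
  shows "smooth_field_on A U (\<lambda>y. \<Sum>i\<in>I. X i y)"
  using assms(2)
  by (induction I rule: infinite_finite_induct)
     (auto intro: smooth_field_on_0[OF assms(1)] smooth_field_on_add[OF assms(1)])

lemma field_in_chart_differentiable:
  assumes "smooth_field_on A U X" "c \<in> A" "x \<in> fst c" "x \<in> U"
  shows "field_in_chart A c X differentiable (at (snd c x))"
  using assms smooth_on_has_derivative[of _ "field_in_chart A c X"]
  unfolding smooth_field_on_def differentiable_def by blast

lemma fun_in_chart_differentiable:
  assumes "smooth_fun_on A U f" "c \<in> A" "x \<in> fst c" "x \<in> U"
  shows "(\<lambda>q. f (chart_inv c q)) differentiable (at (snd c x))"
  using assms smooth_on_has_derivative[of _ "f \<circ> chart_inv c"]
  unfolding smooth_fun_on_def differentiable_def comp_def by blast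

text \<open>A coordinate field is cut off by a bump supported in a closed coordinate ball. The
  product is smooth on the chart domain and zero off the compact image \<open>K\<close> of the ball,
  and these two open sets cover the manifold.\<close>

lemma ex_vector_field: "\<exists>X. vector_field A X \<and> X x = u"
proof -
  define c where "c = chart_at A x"
  have c: "c \<in> A" "x \<in> fst c" by (simp_all add: c_def)
  obtain r where r: "r > 0" "cball (snd c x) r \<subseteq> snd c ` fst c"
    using chart_props(2)[OF c(1)] c(2) open_contains_cball by blast
  define K where "K = chart_inv c ` cball (snd c x) r"
  have "continuous_on (cball (snd c x) r) (chart_inv c)"
    using chart_props(3)[OF c(1)] r(2) by (auto simp: homeomorphism_def intro: continuous_on_subset)
  \<comment> \<open>The Hausdorff axiom enters here: a compact set is closed, so its complement may
    serve as an open set for gluing.\<close>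
  then have K: "closed K"
    unfolding K_def by (intro compact_imp_closed compact_continuous_image) auto
  define f where "f = (\<lambda>y. if y \<in> fst c then bump (snd c x) r (snd c y) else 0)"
  define X where "X = (\<lambda>y. f y *\<^sub>R coord_field c u y)"
  have f0: "f y = 0" if "y \<notin> K" for y
  proof (cases "y \<in> fst c")
    case True
    then have "snd c y \<notin> cball (snd c x) r"
      using that c unfolding K_def by (metis chart_inv_chart image_eqI)
    then show ?thesis using r by (simp add: f_def bump_eq_0)
  qed (simp add: f_def)
  have "smooth_fun_on A (fst c) f"
    unfolding smooth_fun_on_def smooth_on_def
  proof (intro ballI allI)
    fix d k assume d: "d \<in> A"
    have S: "open (snd d ` (fst d \<inter> fst c))"
      using open_chart_image[OF d chart_props(1)[OF c(1)]] .
    have "Ck_on k (snd d ` (fst d \<inter> fst c)) (\<lambda>q. bump (snd c x) r (transition d c q))"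
      by (rule Ck_on_compose[where \<phi> = "transition d c" and f = "bump (snd c x) r", OF S subset_UNIV])
        (use smooth_on_bump[of "snd c x" r] smooth_transition[OF d c(1)] in \<open>simp_all add: smooth_on_def\<close>)
    then show "Ck_on k (snd d ` (fst d \<inter> fst c)) (f \<circ> chart_inv d)"
      by (rule Ck_on_cong[OF S, rotated]) (use d in \<open>auto simp: f_def transition_def\<close>)
  qed
  then have 1: "smooth_field_on A (fst c) X"
    unfolding X_def
    by (intro smooth_field_on_scaleR smooth_field_on_coord_field chart_props(1) c(1))
  have 2: "smooth_field_on A (- K) X"
    by (rule smooth_field_on_cong[OF _ _ smooth_field_on_0]) (use K f0 in \<open>auto simp: X_def\<close>)
  have "K \<subseteq> fst c"
    using r(2) c(1) by (auto simp: K_def)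
  then have "vector_field A X"
    unfolding vector_field_def
    using smooth_field_on_local[of UNIV X] 1 2 K chart_props(1)[OF c(1)] by (metis Compl_iff open_Compl subsetD)
  moreover have "X x = f x *\<^sub>R u"
    by (simp add: X_def coord_field_def flip: c_def) (simp add: c)
  moreover have "f x \<noteq> 0"
    using c bump_center[OF r(1), of "snd c x"] by (simp add: f_def)
  \<comment> \<open>Dividing by the constant \<open>f x\<close> corrects the unnormalized height of
    the bump.\<close>
  ultimately have "vector_field A (\<lambda>y. inverse (f x) *\<^sub>R X y) \<and> inverse (f x) *\<^sub>R X x = u"
    unfolding vector_field_def by (auto intro: smooth_field_on_scaleR smooth_fun_on_const)
  then show ?thesis by blast
qed

end

section \<open>Orthogonal frames and cometrics\<close>

definition inner_form :: "('e::real_vector \<Rightarrow> 'e \<Rightarrow> real) \<Rightarrow> bool" where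
  "inner_form B \<longleftrightarrow> bilinear B \<and> (\<forall>u v. B u v = B v u) \<and> (\<forall>u. u \<noteq> 0 \<longrightarrow> B u u > 0)"

lemma inner_formD:
  assumes "inner_form B"
  shows "bilinear B" "B u v = B v u" "u \<noteq> 0 \<Longrightarrow> B u u > 0" "B u u \<ge> 0" "B u u = 0 \<longleftrightarrow> u = 0"
    "linear (B u)" "linear (\<lambda>u. B u v)"
proof -
  show b: "bilinear B" and s: "B u v = B v u" and p: "u \<noteq> 0 \<Longrightarrow> B u u > 0" for u v
    using assms by (auto simp: inner_form_def)
  show "linear (B u)" "linear (\<lambda>u. B u v)"
    using b by (auto simp: bilinear_def)
  show "B u u \<ge> 0" "B u u = 0 \<longleftrightarrow> u = 0"
    using p[of u] bilinear_lzero[OF b] by (cases "u = 0"; force)+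
qed

lemma inner_form_eqI:
  assumes "inner_form B" "subspace E" "u \<in> E" "v \<in> E" "\<And>w. w \<in> E \<Longrightarrow> B u w = B v w"
  shows "u = v"
proof -
  have "B (u - v) (u - v) = 0"
    using assms(5)[OF subspace_diff[OF assms(2-4)]] bilinear_lsub[OF inner_formD(1)[OF assms(1)]] by simp
  then show ?thesis using inner_formD(5)[OF assms(1)] by simp
qed

definition orthogonal_basis :: "('e::real_vector \<Rightarrow> 'e \<Rightarrow> real) \<Rightarrow> nat \<Rightarrow> (nat \<Rightarrow> 'e) \<Rightarrow> 'e set \<Rightarrow> bool" where
  "orthogonal_basis B k e E \<longleftrightarrow> (\<forall>i<k. e i \<noteq> 0) \<and> (\<forall>i<k. \<forall>j<k. i \<noteq> j \<longrightarrow> B (e i) (e j) = 0) \<and>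
     span (e ` {..<k}) = E"

text \<open>The basis is not normalized, which spares square roots in the smoothness proofs.\<close>

definition riesz_vec :: "('e::real_vector \<Rightarrow> 'e \<Rightarrow> real) \<Rightarrow> nat \<Rightarrow> (nat \<Rightarrow> 'e) \<Rightarrow> ('e \<Rightarrow> real) \<Rightarrow> 'e" where
  "riesz_vec B k e p = (\<Sum>i<k. (p (e i) / B (e i) (e i)) *\<^sub>R e i)"

lemma riesz_vec:
  assumes "inner_form B" "orthogonal_basis B k e E"
  shows "riesz_vec B k e p \<in> E" "linear p \<Longrightarrow> w \<in> E \<Longrightarrow> B (riesz_vec B k e p) w = p w"
proof -
  have E: "E = span (e ` {..<k})"
    using assms(2) by (simp add: orthogonal_basis_def)
  show "riesz_vec B k e p \<in> E"
    unfolding riesz_vec_def E by (intro span_sum span_scale span_base) auto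
  assume p: "linear p" and w: "w \<in> E"
  show "B (riesz_vec B k e p) w = p w"
  proof (rule linear_eq_on[OF inner_formD(6)[OF assms(1)] p])
    show "w \<in> span (e ` {..<k})" using w E by simp
    fix b assume "b \<in> e ` {..<k}"
    then obtain j where j: "j < k" "b = e j" by auto
    have "B (riesz_vec B k e p) b = (\<Sum>i<k. (p (e i) / B (e i) (e i)) * B (e i) b)"
      unfolding riesz_vec_def
      by (simp add: linear_sum[OF inner_formD(7)[OF assms(1)]] linear_cmul[OF inner_formD(7)[OF assms(1)]])
    also have "\<dots> = (\<Sum>i<k. if i = j then p (e j) else 0)"
      using assms(2) j inner_formD(5)[OF assms(1)] by (intro sum.cong) (auto simp: orthogonal_basis_def)
    finally show "B (riesz_vec B k e p) b = p b"
      using j by simp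
  qed
qed

lemma pr_eqI:
  assumes "inner_form (g x)" "subspace (E x)" "u \<in> E x" "\<And>w. w \<in> E x \<Longrightarrow> g x (X x) w = g x u w"
  shows "pr g E X x = u"
  unfolding pr_def
proof (rule the_equality)
  have l: "g x (X x - u) w = g x (X x) w - g x u w" for u w
    using bilinear_lsub[OF inner_formD(1)[OF assms(1)]] .
  then show "u \<in> E x \<and> (\<forall>w\<in>E x. g x (X x - u) w = 0)"
    using assms(3,4) by auto
  fix u' assume "u' \<in> E x \<and> (\<forall>w\<in>E x. g x (X x - u') w = 0)"
  then have u': "u' \<in> E x" "\<And>w. w \<in> E x \<Longrightarrow> g x (X x) w = g x u' w"
    using l by auto
  show "u' = u"
    by (rule inner_form_eqI[OF assms(1,2) u'(1) assms(3)]) (simp add: u'(2)[symmetric] assms(4)[symmetric])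
qed

text \<open>The values of \<open>L\<close> on the dual basis are the coordinates of the vector. This
  makes the \<open>THE\<close> in \<open>sharp\<close> denote for every form that is linear in its
  second argument.\<close>

lemma dual_reflexive:
  fixes L :: "('e::euclidean_space \<Rightarrow>\<^sub>L real) \<Rightarrow> real"
  assumes "linear L"
  shows "\<exists>v. \<forall>q. blinfun_apply q v = L q"
proof (intro exI allI)
  fix q :: "'e \<Rightarrow>\<^sub>L real"
  have "q = (\<Sum>b\<in>Basis. blinfun_apply q b *\<^sub>R blinfun_inner_left b)"
  proof (rule blinfun_eqI)
    fix x
    have "blinfun_apply q x = blinfun_apply q (\<Sum>b\<in>Basis. (x \<bullet> b) *\<^sub>R b)"
      by (simp add: euclidean_representation)
    also have "\<dots> = blinfun_apply (\<Sum>b\<in>Basis. blinfun_apply q b *\<^sub>R blinfun_inner_left b) x"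
      by (simp add: blinfun.sum_right blinfun.sum_left blinfun.scaleR_right blinfun.scaleR_left mult.commute)
    finally show "blinfun_apply q x = blinfun_apply (\<Sum>b\<in>Basis. blinfun_apply q b *\<^sub>R blinfun_inner_left b) x" .
  qed
  then have "L q = L (\<Sum>b\<in>Basis. blinfun_apply q b *\<^sub>R blinfun_inner_left b)" by simp
  then show "blinfun_apply q (\<Sum>b\<in>Basis. L (blinfun_inner_left b) *\<^sub>R b) = L q"
    by (simp add: linear_sum[OF assms] linear_cmul[OF assms] blinfun.sum_right blinfun.scaleR_right mult.commute)
qed

lemma dual_separates:
  fixes v w :: "'e::euclidean_space"
  assumes "\<And>q::'e \<Rightarrow>\<^sub>L real. blinfun_apply q v = blinfun_apply q w"
  shows "v = w"
proof -
  have "v \<bullet> u = w \<bullet> u" for u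
    using assms[of "blinfun_inner_left u"] by simp
  then show ?thesis using vector_eq_ldot by (metis inner_commute)
qed

lemma sharp_eqI: "(\<And>q. blinfun_apply q v = \<sigma> p q) \<Longrightarrow> sharp \<sigma> p = v"
  unfolding sharp_def by (rule the_equality) (auto intro: dual_separates)

text \<open>Replaces the definite description by a Riesz map \<open>r\<close>. For uniqueness, write
  \<open>w\<close> in \<open>E x\<close> as \<open>sharp \<sigma> q\<close>: the isometry condition
  gives \<open>B (sharp \<sigma> p) w = \<sigma> p q\<close>, and symmetry turns the right side into
  \<open>p\<close> applied to \<open>w\<close>, so \<open>sharp \<sigma>\<close> agrees with
  \<open>r\<close>. For existence, \<open>rr\<close> shows that \<open>r\<close> reaches all of
  \<open>E x\<close>, with the covector \<open>B w\<close> as preimage of \<open>w\<close>.\<close>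

lemma cometric_eq:
  fixes s :: "'m \<Rightarrow> 'e::euclidean_space \<Rightarrow> 'e \<Rightarrow> real"
  assumes B: "inner_form B" and E: "subspace (E x)"
    and s: "\<And>u v. u \<in> E x \<Longrightarrow> v \<in> E x \<Longrightarrow> s x u v = B u v"
    and r: "\<And>p. r p \<in> E x" "\<And>p w. w \<in> E x \<Longrightarrow> B (r p) w = blinfun_apply p w"
  shows "cometric E s x p q = blinfun_apply q (r p)"
proof -
  define \<tau> :: "('e \<Rightarrow>\<^sub>L real) \<Rightarrow> ('e \<Rightarrow>\<^sub>L real) \<Rightarrow> real" where "\<tau> = (\<lambda>p q. blinfun_apply q (r p))"
  have sharp: "sharp \<tau> p = r p" for p
    by (rule sharp_eqI) (simp add: \<tau>_def)
  have linr: "linear r"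
  proof (rule linearI)
    fix p q c
    show "r (p + q) = r p + r q"
      by (rule inner_form_eqI[OF B E])
         (auto simp: r bilinear_ladd[OF inner_formD(1)[OF B]] blinfun.add_left subspace_add[OF E])
    show "r (c *\<^sub>R p) = c *\<^sub>R r p"
      by (rule inner_form_eqI[OF B E])
         (auto simp: r bilinear_lmul[OF inner_formD(1)[OF B]] blinfun.scaleR_left subspace_scale[OF E])
  qed
  have rr: "r (Blinfun (B w)) = w" if "w \<in> E x" for w
    by (rule inner_form_eqI[OF B E])
       (use that inner_formD(6)[OF B] in \<open>auto simp: r bounded_linear_Blinfun_apply linear_conv_bounded_linear\<close>)
  have "cometric E s x = \<tau>"
    unfolding cometric_def
  proof (rule the_equality)
    have "bilinear \<tau>"
      using linr by (auto simp: bilinear_def \<tau>_def linear_iff blinfun.bilinear_simps)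
    moreover have "\<tau> p q = \<tau> q p" for p q
      unfolding \<tau>_def using r inner_formD(2)[OF B] by metis
    moreover have "\<tau> p p \<ge> 0" for p
      unfolding \<tau>_def using r inner_formD(4)[OF B] by metis
    moreover have "range (sharp \<tau>) = E x"
      using r(1) rr by (auto simp: sharp) (metis rangeI)
    moreover have "s x (sharp \<tau> p) (sharp \<tau> q) = \<tau> p q" for p q
      unfolding sharp using r s inner_formD(2)[OF B, of "r p"] by (simp add: \<tau>_def)
    ultimately show "bilinear \<tau> \<and> (\<forall>p q. \<tau> p q = \<tau> q p) \<and> (\<forall>p. \<tau> p p \<ge> 0) \<and>
       range (sharp \<tau>) = E x \<and> (\<forall>p q. s x (sharp \<tau> p) (sharp \<tau> q) = \<tau> p q)" by blast
  next
    fix \<sigma> :: "('e \<Rightarrow>\<^sub>L real) \<Rightarrow> ('e \<Rightarrow>\<^sub>L real) \<Rightarrow> real"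
    assume \<sigma>: "bilinear \<sigma> \<and> (\<forall>p q. \<sigma> p q = \<sigma> q p) \<and> (\<forall>p. \<sigma> p p \<ge> 0) \<and>
       range (sharp \<sigma>) = E x \<and> (\<forall>p q. s x (sharp \<sigma> p) (sharp \<sigma> q) = \<sigma> p q)"
    have ap: "blinfun_apply q (sharp \<sigma> p) = \<sigma> p q" for p q
    proof -
      obtain v where v: "\<And>q. blinfun_apply q v = \<sigma> p q"
        using \<sigma> dual_reflexive[of "\<sigma> p"] by (auto simp: bilinear_def)
      then show ?thesis using sharp_eqI[of v \<sigma> p] by simp
    qed
    have mem: "sharp \<sigma> p \<in> E x" for p
      using \<sigma> by blast
    have "sharp \<sigma> p = r p" for p
    proof (rule inner_form_eqI[OF B E mem r(1)])
      fix w assume "w \<in> E x"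
      then obtain q where q: "w = sharp \<sigma> q" using \<sigma> by blast
      have "B (sharp \<sigma> p) w = \<sigma> p q"
        using \<sigma> s[OF mem mem] q by metis
      also have "\<dots> = blinfun_apply p w"
        using \<sigma> ap q by metis
      finally show "B (sharp \<sigma> p) w = B (r p) w"
        using r(2) \<open>w \<in> E x\<close> by simp
    qed
    then show "\<sigma> = \<tau>"
      using ap by (auto simp: fun_eq_iff \<tau>_def)
  qed
  then show ?thesis by (simp add: \<tau>_def)
qed

text \<open>Otherwise the index \<open>n\<close> could be dropped, leaving at most
  \<open>k - 1\<close> vectors to span a space of dimension \<open>k\<close>. In Gram-Schmidt this
  keeps the new vector from vanishing.\<close>

lemma dim_span_imp_notin_span:
  fixes b :: "nat \<Rightarrow> 'e::euclidean_space"
  assumes "dim (span (b ` {..<k})) = k" "n < k"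
  shows "b n \<notin> span (b ` {..<n})"
proof
  assume "b n \<in> span (b ` {..<n})"
  moreover have "b ` {..<n} \<subseteq> b ` ({..<k} - {n})"
    using assms(2) by auto
  ultimately have "b n \<in> span (b ` ({..<k} - {n}))"
    using span_mono by blast
  then have "span (insert (b n) (b ` ({..<k} - {n}))) = span (b ` ({..<k} - {n}))"
    by (rule span_redundant)
  moreover have "insert (b n) (b ` ({..<k} - {n})) = b ` {..<k}"
    using assms(2) by auto
  ultimately have "dim (span (b ` {..<k})) \<le> card (b ` ({..<k} - {n}))"
    by (intro dim_le_card) auto
  also have "\<dots> \<le> card ({..<k} - {n})"
    by (rule card_image_le) simp
  also have "\<dots> < k" using assms(2) by simp
  finally show False using assms(1) by simp
qed

locale riemannian_atlas = smooth_atlas A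
  for A :: "('m::{t2_space,second_countable_topology}, 'e::euclidean_space) chart set" +
  fixes g :: "'m \<Rightarrow> 'e \<Rightarrow> 'e \<Rightarrow> real"
  assumes riemannian_metric: "riemannian_metric A g"
begin

lemma inner_form_metric: "inner_form (g x)"
proof -
  note m = riemannian_metric[unfolded riemannian_metric_def metric_tensor_on_def]
  have l: "g x (a *\<^sub>R u + b *\<^sub>R v) w = a * g x u w + b * g x v w" for a b u v w
    using m[THEN conjunct1] by blast
  have s: "g x u v = g x v u" for u v
    using m[THEN conjunct2, THEN conjunct1] by blast
  have p: "u \<noteq> 0 \<Longrightarrow> g x u u > 0" for u
    using m[THEN conjunct2, THEN conjunct2, THEN conjunct1] by blast
  have "linear (\<lambda>u. g x u w)" for w
    using l[of 1 _ 1 _ w] l[of _ _ 0 0 w] by (intro linearI) auto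
  moreover from this have "linear (\<lambda>w. g x u w)" for u
    by (subst s)
  ultimately show ?thesis
    using s p by (simp add: inner_form_def bilinear_def)
qed

lemmas metricD = inner_formD[OF inner_form_metric]

lemma smooth_fun_on_metric:
  "open U \<Longrightarrow> smooth_field_on A U X \<Longrightarrow> smooth_field_on A U Y \<Longrightarrow> smooth_fun_on A U (\<lambda>x. g x (X x) (Y x))"
  using riemannian_metric[unfolded riemannian_metric_def metric_tensor_on_def, THEN conjunct2, THEN conjunct2, THEN conjunct2]
  by blast

lemma smooth_field_on_riesz_vec:
  assumes U: "open U" and "\<And>i. i < k \<Longrightarrow> smooth_field_on A U (e i)"
    and "\<And>i. i < k \<Longrightarrow> smooth_fun_on A U (\<lambda>y. p y (e i y))"
    and "\<And>i y. i < k \<Longrightarrow> y \<in> U \<Longrightarrow> e i y \<noteq> 0"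
  shows "smooth_field_on A U (\<lambda>y. riesz_vec (g y) k (\<lambda>i. e i y) (p y))"
  unfolding riesz_vec_def divide_inverse
  using assms(2-) metricD(5)
  by (intro smooth_field_on_sum[OF U] smooth_field_on_scaleR[OF U] smooth_fun_on_mult[OF U]
      smooth_fun_on_inverse[OF U] smooth_fun_on_metric[OF U]) auto

text \<open>Each step subtracts from the next field its projection to the span of the earlier ones.
  Constant rank on \<open>U\<close> keeps the result nonzero everywhere there, so the squared
  lengths stay invertible and the same \<open>U\<close> serves all steps. The partial spans are
  matched for every \<open>n\<close> because the projection in the next step needs them.\<close>

lemma gram_schmidt:
  assumes U: "open U" and b: "\<And>i. i < k \<Longrightarrow> smooth_field_on A U (b i)"
    and dim: "\<And>y. y \<in> U \<Longrightarrow> dim (span ((\<lambda>i. b i y) ` {..<k})) = k"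
    and "n \<le> k"
  shows "\<exists>e. (\<forall>i<n. smooth_field_on A U (e i)) \<and>
    (\<forall>y\<in>U. orthogonal_basis (g y) n (\<lambda>i. e i y) (span ((\<lambda>i. b i y) ` {..<n})))"
  using assms(4)
proof (induction n)
  case 0
  then show ?case by (simp add: orthogonal_basis_def)
next
  case (Suc n)
  then obtain e where e: "\<And>i. i < n \<Longrightarrow> smooth_field_on A U (e i)"
    and o: "\<And>y. y \<in> U \<Longrightarrow> orthogonal_basis (g y) n (\<lambda>i. e i y) (span ((\<lambda>i. b i y) ` {..<n}))"
    by auto
  define r where "r = (\<lambda>y. riesz_vec (g y) n (\<lambda>i. e i y) (g y (b n y)))"
  define e' where "e' = e(n := \<lambda>y. b n y - r y)"
  have "smooth_field_on A U (e' i)" if "i < Suc n" for i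
  proof (cases "i = n")
    case True
    have "smooth_field_on A U r"
      unfolding r_def using Suc.prems o b e
      by (intro smooth_field_on_riesz_vec[OF U] smooth_fun_on_metric[OF U]) (auto simp: orthogonal_basis_def)
    then show ?thesis
      using True Suc.prems b by (auto simp: e'_def intro!: smooth_field_on_diff[OF U])
  qed (use that e in \<open>auto simp: e'_def\<close>)
  moreover have "orthogonal_basis (g y) (Suc n) (\<lambda>i. e' i y) (span ((\<lambda>i. b i y) ` {..<Suc n}))" if y: "y \<in> U" for y
  proof -
    let ?S = "span ((\<lambda>i. b i y) ` {..<n})"
    have r: "r y \<in> ?S" "w \<in> ?S \<Longrightarrow> g y (r y) w = g y (b n y) w" for w
      unfolding r_def using riesz_vec[OF inner_form_metric o[OF y]] metricD(6) by auto
    have notin: "b n y \<notin> ?S"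
      using dim_span_imp_notin_span[of "\<lambda>i. b i y" k n] dim[OF y] Suc.prems by auto
    have S: "span ((\<lambda>i. e i y) ` {..<n}) = ?S"
      using o[OF y] by (simp add: orthogonal_basis_def)
    have im: "(\<lambda>i. e' i y) ` {..<Suc n} = insert (b n y - r y) ((\<lambda>i. e i y) ` {..<n})"
      by (auto simp: e'_def lessThan_Suc)
    have "span (insert (b n y - r y) ((\<lambda>i. e i y) ` {..<n})) = span (insert (b n y) ((\<lambda>i. e i y) ` {..<n}))"
      by (rule eq_span_insert_eq) (use r(1) S span_neg in auto)
    also have "\<dots> = span (insert (b n y) ((\<lambda>i. b i y) ` {..<n}))"
      by (simp add: span_insert S)
    finally have "span ((\<lambda>i. e' i y) ` {..<Suc n}) = span ((\<lambda>i. b i y) ` {..<Suc n})"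
      unfolding im by (simp add: lessThan_Suc)
    moreover have "e' i y \<noteq> 0" if "i < Suc n" for i
      using that o[OF y] notin r(1) by (auto simp: e'_def orthogonal_basis_def)
    moreover have "g y (e' i y) (e' j y) = 0" if "i < Suc n" "j < Suc n" "i \<noteq> j" for i j
    proof -
      have ei: "e l y \<in> ?S" if "l < n" for l
        using that S span_base by (metis imageI lessThan_iff)
      have "g y (b n y - r y) (e l y) = 0" if "l < n" for l
        using r(2)[OF ei[OF that]] bilinear_lsub[OF metricD(1)] by simp
      then show ?thesis
        using that o[OF y] metricD(2) by (auto simp: e'_def orthogonal_basis_def)
    qed
    ultimately show ?thesis by (simp add: orthogonal_basis_def)
  qed
  ultimately show ?case by (intro exI[of _ e']) blast
qed

lemma orthogonal_frame:
  assumes "subbundle A E"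
  obtains U k e where "open U" "x \<in> U" "\<And>i. i < k \<Longrightarrow> smooth_field_on A U (e i)"
    "\<And>y. y \<in> U \<Longrightarrow> orthogonal_basis (g y) k (\<lambda>i. e i y) (E y)"
proof -
  obtain U k b where U: "open U" "x \<in> U" "\<And>i. i < k \<Longrightarrow> smooth_field_on A U (b i)"
    "\<And>y. y \<in> U \<Longrightarrow> E y = span ((\<lambda>i. b i y) ` {..<k}) \<and> dim (E y) = k"
    using assms unfolding subbundle_def by metis
  show ?thesis
    using gram_schmidt[of U k b k] U that by (metis order_refl)
qed

text \<open>Supplies orthogonal frames of the whole tangent bundle; the sharp map of
  \<open>V\<close> is later found by subtracting that of \<open>H\<close> from the one built
  here.\<close>

lemma subbundle_UNIV: "subbundle A (\<lambda>x. UNIV)"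
  unfolding subbundle_def
proof
  fix x
  define c where "c = chart_at A x"
  have c: "c \<in> A" "x \<in> fst c" by (simp_all add: c_def)
  obtain b :: "nat \<Rightarrow> 'e" where b: "b ` {..<DIM('e)} = Basis"
    using ex_bij_betw_nat_finite[OF finite_Basis] unfolding bij_betw_def atLeast0LessThan by metis
  have "span ((\<lambda>i. coord_field c (b i) y) ` {..<DIM('e)}) = UNIV" if "y \<in> fst c" for y
  proof -
    have "(\<lambda>i. coord_field c (b i) y) ` {..<DIM('e)} = (\<lambda>a. coord_field c a y) ` Basis"
      using image_image[of "\<lambda>a. coord_field c a y" b "{..<DIM('e)}"] by (simp only: b)
    then have "span ((\<lambda>i. coord_field c (b i) y) ` {..<DIM('e)}) = range (\<lambda>a. coord_field c a y)"
      using linear_coord_field[OF c(1) that] by (simp add: linear_span_image)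
    also have "\<dots> = UNIV"
      using coord_field_tangent_coord[OF c(1) that] by (metis surjI)
    finally show ?thesis .
  qed
  then show "\<exists>U k B. open U \<and> x \<in> U \<and> (\<forall>i<k. smooth_field_on A U (B i)) \<and>
     (\<forall>y\<in>U. UNIV = span ((\<lambda>i. B i y) ` {..<k}) \<and> dim (UNIV :: 'e set) = k)"
    using c smooth_field_on_coord_field[OF c(1)] chart_props(1)[OF c(1)]
    by (intro exI[of _ "fst c"] exI[of _ "DIM('e)"] exI[of _ "\<lambda>i. coord_field c (b i)"]) auto
qed

lemma subspace_subbundle: "subbundle A E \<Longrightarrow> subspace (E x)"
  unfolding subbundle_def by (metis subspace_span)

lemma pr_eq_riesz_vec:
  assumes "orthogonal_basis (g x) k e (E x)"
  shows "pr g E X x = riesz_vec (g x) k e (g x (X x))"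
proof (rule pr_eqI)
  show "inner_form (g x)" by (rule inner_form_metric)
  show "subspace (E x)"
    using assms subspace_span by (metis orthogonal_basis_def)
qed (simp_all add: riesz_vec[OF inner_form_metric assms] metricD(6))

lemma pr_props:
  assumes "subbundle A E"
  shows "pr g E X x \<in> E x" "w \<in> E x \<Longrightarrow> g x (pr g E X x) w = g x (X x) w"
proof -
  obtain k and e :: "nat \<Rightarrow> 'm \<Rightarrow> 'e" where o: "orthogonal_basis (g x) k (\<lambda>i. e i x) (E x)"
    using orthogonal_frame[OF assms, of x] by metis
  have "pr g E X x = riesz_vec (g x) k (\<lambda>i. e i x) (g x (X x))"
    using pr_eq_riesz_vec[of x k "\<lambda>i. e i x" E X] o by simp
  then show "pr g E X x \<in> E x" "w \<in> E x \<Longrightarrow> g x (pr g E X x) w = g x (X x) w"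
    using riesz_vec[OF inner_form_metric o] metricD(6) by auto
qed

lemma smooth_field_on_pr:
  assumes "subbundle A E" "vector_field A X"
  shows "vector_field A (pr g E X)"
  unfolding vector_field_def
proof (rule smooth_field_on_local)
  fix x
  obtain U k e where U: "open U" "x \<in> U" "\<And>i. i < k \<Longrightarrow> smooth_field_on A U (e i)"
    and o: "\<And>y. y \<in> U \<Longrightarrow> orthogonal_basis (g y) k (\<lambda>i. e i y) (E y)"
    using orthogonal_frame[OF assms(1), of x] by metis
  have X: "smooth_field_on A U X"
    using assms(2) smooth_field_on_subset unfolding vector_field_def by blast
  have "smooth_field_on A U (\<lambda>y. riesz_vec (g y) k (\<lambda>i. e i y) (g y (X y)))"
    using o U X
    by (intro smooth_field_on_riesz_vec smooth_fun_on_metric) (auto simp: orthogonal_basis_def)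
  moreover have "riesz_vec (g y) k (\<lambda>i. e i y) (g y (X y)) = pr g E X y" if "y \<in> U" for y
    using pr_eq_riesz_vec[of y k "\<lambda>i. e i y" E X] o[OF that] by simp
  ultimately have "smooth_field_on A U (pr g E X)"
    by (rule smooth_field_on_cong[OF U(1), rotated])
  then show "\<exists>W. open W \<and> x \<in> W \<and> smooth_field_on A W (pr g E X)"
    using U by blast
qed

end

section \<open>Lie derivatives and Hamiltonian fields in a chart\<close>

lemma has_derivative_eventually_transform:
  assumes "(f has_derivative f') (at x)" "\<forall>\<^sub>F y in nhds x. f y = g y"
  shows "(g has_derivative f') (at x)"
  using assms eventually_nhds_x_imp_x[OF assms(2)]
  by (intro has_derivative_transform_eventually[OF assms(1)]) (auto simp: eventually_at_filter elim: eventually_mono)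

lemma bilinear_expansion: "bilinear B \<Longrightarrow> B a b = (\<Sum>i\<in>Basis. \<Sum>j\<in>Basis. (a \<bullet> i) * (b \<bullet> j) * B i j)"
proof -
  assume B: "bilinear B"
  have "B a b = B (\<Sum>i\<in>Basis. (a \<bullet> i) *\<^sub>R i) (\<Sum>j\<in>Basis. (b \<bullet> j) *\<^sub>R j)"
    by (simp add: euclidean_representation)
  also have "\<dots> = (\<Sum>i\<in>Basis. \<Sum>j\<in>Basis. (a \<bullet> i) * (b \<bullet> j) * B i j)"
    by (simp add: bilinear_sum[OF B] sum.cartesian_product bilinear_lmul[OF B] bilinear_rmul[OF B] mult_ac)
  finally show ?thesis .
qed

text \<open>Coordinates of a metric near one point. Bilinearity is asked only near
  \<open>q\<^sub>0\<close>, since outside the image of the chart \<open>chart_inv\<close> has no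
  geometric meaning; symmetry is inherited from the metric at whatever point it returns.\<close>

locale metric_germ =
  fixes G :: "'e::euclidean_space \<Rightarrow> 'e \<Rightarrow> 'e \<Rightarrow> real" and q\<^sub>0 :: 'e
  assumes sym: "G q a b = G q b a"
    and bilinear: "\<forall>\<^sub>F q in nhds q\<^sub>0. bilinear (G q)"
    and differentiable: "(\<lambda>q. G q a b) differentiable (at q\<^sub>0)"
begin

abbreviation deriv :: "('e \<Rightarrow> 'b::real_normed_vector) \<Rightarrow> 'e \<Rightarrow> 'b" where
  "deriv f \<equiv> frechet_derivative f (at q\<^sub>0)"

lemma bilinear_center: "bilinear (G q\<^sub>0)"
  using bilinear by (rule eventually_nhds_x_imp_x)

lemmas center_linear = bilinear_ladd[OF bilinear_center] bilinear_radd[OF bilinear_center]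
  bilinear_lsub[OF bilinear_center] bilinear_rsub[OF bilinear_center]
  bilinear_lmul[OF bilinear_center] bilinear_rmul[OF bilinear_center]

text \<open>The derivative of \<open>G\<close> in direction \<open>v\<close> with both arguments
  frozen. Writing it over \<open>Basis\<close> makes it bilinear in \<open>a\<close> and
  \<open>b\<close> by inspection and involves only the finitely many coefficient functions of
  \<open>G\<close>.\<close>

definition metric_diff :: "'e \<Rightarrow> 'e \<Rightarrow> 'e \<Rightarrow> real" where
  "metric_diff v a b = (\<Sum>i\<in>Basis. \<Sum>j\<in>Basis. (a \<bullet> i) * (b \<bullet> j) * deriv (\<lambda>q. G q i j) v)"

lemma metric_diff_sym: "metric_diff v a b = metric_diff v b a"
proof -
  have "(\<lambda>q. G q i j) = (\<lambda>q. G q j i)" for i j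
    by (rule ext) (rule sym)
  then show ?thesis
    unfolding metric_diff_def
    by (subst sum.swap) (simp add: mult.commute mult.left_commute)
qed

lemma metric_diff_linear:
  "metric_diff v (a + a') b = metric_diff v a b + metric_diff v a' b"
  "metric_diff v (t *\<^sub>R a) b = t * metric_diff v a b"
  "metric_diff (t *\<^sub>R v) a b = t * metric_diff v a b"
  unfolding metric_diff_def
  by (simp_all add: inner_add_left distrib_right sum.distrib sum_distrib_left mult.assoc
      linear_cmul[OF linear_frechet_derivative[OF differentiable]])
    (simp add: mult.left_commute)

text \<open>Near the base point \<open>G\<close> is the finite sum of its coefficients times
  coordinates, to which the ordinary product rule applies; the three groups of terms are then
  reassembled by bilinearity.\<close>

lemma product_rule:
  assumes Y: "(Y has_derivative Y') (at q\<^sub>0)" and Z: "(Z has_derivative Z') (at q\<^sub>0)"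
  shows "((\<lambda>q. G q (Y q) (Z q)) has_derivative
    (\<lambda>v. metric_diff v (Y q\<^sub>0) (Z q\<^sub>0) + G q\<^sub>0 (Y' v) (Z q\<^sub>0) + G q\<^sub>0 (Y q\<^sub>0) (Z' v))) (at q\<^sub>0)"
proof -
  have G: "((\<lambda>q. G q i j) has_derivative deriv (\<lambda>q. G q i j)) (at q\<^sub>0)" for i j
    using differentiable frechet_derivative_works by blast
  have "((\<lambda>q. \<Sum>i\<in>Basis. \<Sum>j\<in>Basis. (Y q \<bullet> i) * (Z q \<bullet> j) * G q i j) has_derivative
    (\<lambda>v. \<Sum>i\<in>Basis. \<Sum>j\<in>Basis. (Y q\<^sub>0 \<bullet> i) * (Z q\<^sub>0 \<bullet> j) * deriv (\<lambda>q. G q i j) v +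
      ((Y q\<^sub>0 \<bullet> i) * (Z' v \<bullet> j) + (Y' v \<bullet> i) * (Z q\<^sub>0 \<bullet> j)) * G q\<^sub>0 i j)) (at q\<^sub>0)"
    by (intro has_derivative_sum has_derivative_mult has_derivative_inner_left Y Z G)
  moreover have "(\<lambda>v. \<Sum>i\<in>Basis. \<Sum>j\<in>Basis. (Y q\<^sub>0 \<bullet> i) * (Z q\<^sub>0 \<bullet> j) * deriv (\<lambda>q. G q i j) v +
      ((Y q\<^sub>0 \<bullet> i) * (Z' v \<bullet> j) + (Y' v \<bullet> i) * (Z q\<^sub>0 \<bullet> j)) * G q\<^sub>0 i j) =
    (\<lambda>v. metric_diff v (Y q\<^sub>0) (Z q\<^sub>0) + G q\<^sub>0 (Y' v) (Z q\<^sub>0) + G q\<^sub>0 (Y q\<^sub>0) (Z' v))"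
  proof
    fix v
    show "(\<Sum>i\<in>Basis. \<Sum>j\<in>Basis. (Y q\<^sub>0 \<bullet> i) * (Z q\<^sub>0 \<bullet> j) * deriv (\<lambda>q. G q i j) v +
      ((Y q\<^sub>0 \<bullet> i) * (Z' v \<bullet> j) + (Y' v \<bullet> i) * (Z q\<^sub>0 \<bullet> j)) * G q\<^sub>0 i j) =
      metric_diff v (Y q\<^sub>0) (Z q\<^sub>0) + G q\<^sub>0 (Y' v) (Z q\<^sub>0) + G q\<^sub>0 (Y q\<^sub>0) (Z' v)"
      unfolding bilinear_expansion[OF bilinear_center, of "Y' v"] bilinear_expansion[OF bilinear_center, of "Y q\<^sub>0"]
        metric_diff_def sum.distrib[symmetric]
      by (intro sum.cong refl) (simp add: algebra_simps)
  qed
  ultimately have "((\<lambda>q. \<Sum>i\<in>Basis. \<Sum>j\<in>Basis. (Y q \<bullet> i) * (Z q \<bullet> j) * G q i j) has_derivative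
    (\<lambda>v. metric_diff v (Y q\<^sub>0) (Z q\<^sub>0) + G q\<^sub>0 (Y' v) (Z q\<^sub>0) + G q\<^sub>0 (Y q\<^sub>0) (Z' v))) (at q\<^sub>0)"
    by simp
  moreover have "\<forall>\<^sub>F q in nhds q\<^sub>0. (\<Sum>i\<in>Basis. \<Sum>j\<in>Basis. (Y q \<bullet> i) * (Z q \<bullet> j) * G q i j) = G q (Y q) (Z q)"
    using bilinear by eventually_elim (rule bilinear_expansion[symmetric])
  ultimately show ?thesis
    by (rule has_derivative_eventually_transform)
qed

text \<open>Expanding $(L_U G)(Y,Z) = U(G(Y,Z)) - G([U,Y],Z) - G(Y,[U,Z])$, the derivatives of \<open>Y\<close> and \<open>Z\<close>
  cancel, so only their values \<open>y\<close> and \<open>z\<close> at the base point enter.\<close>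

definition lie_deriv :: "('e \<Rightarrow> 'e) \<Rightarrow> 'e \<Rightarrow> 'e \<Rightarrow> real" where
  "lie_deriv U y z = metric_diff (U q\<^sub>0) y z + G q\<^sub>0 (deriv U y) z + G q\<^sub>0 y (deriv U z)"

lemma lie_deriv_eq_bracket:
  assumes "Y differentiable (at q\<^sub>0)" "Z differentiable (at q\<^sub>0)"
  shows "deriv (\<lambda>q. G q (Y q) (Z q)) (U q\<^sub>0)
    - G q\<^sub>0 (deriv Y (U q\<^sub>0) - deriv U (Y q\<^sub>0)) (Z q\<^sub>0)
    - G q\<^sub>0 (Y q\<^sub>0) (deriv Z (U q\<^sub>0) - deriv U (Z q\<^sub>0)) = lie_deriv U (Y q\<^sub>0) (Z q\<^sub>0)"
proof -
  have "deriv (\<lambda>q. G q (Y q) (Z q)) (U q\<^sub>0) =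
    metric_diff (U q\<^sub>0) (Y q\<^sub>0) (Z q\<^sub>0) + G q\<^sub>0 (deriv Y (U q\<^sub>0)) (Z q\<^sub>0) + G q\<^sub>0 (Y q\<^sub>0) (deriv Z (U q\<^sub>0))"
    using frechet_derivative_at[OF product_rule[OF assms[unfolded frechet_derivative_works]]] by (simp add: fun_eq_iff)
  then show ?thesis by (simp add: lie_deriv_def center_linear)
qed

lemma lie_deriv_add:
  assumes "U differentiable (at q\<^sub>0)"
  shows "lie_deriv U (y + z) (y + z) = lie_deriv U y y + 2 * lie_deriv U y z + lie_deriv U z z"
proof -
  have r: "metric_diff v a (b + b') = metric_diff v a b + metric_diff v a b'" for v a b b'
    by (metis metric_diff_sym metric_diff_linear(1))
  show ?thesis
    using metric_diff_sym[of "U q\<^sub>0" y z] sym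
    by (simp add: lie_deriv_def center_linear r metric_diff_linear linear_add[OF linear_frechet_derivative[OF assms]])
qed

lemma lie_deriv_scale:
  assumes "U differentiable (at q\<^sub>0)"
  shows "lie_deriv U (t *\<^sub>R y) (t *\<^sub>R y) = t\<^sup>2 * lie_deriv U y y"
    "lie_deriv (\<lambda>q. t *\<^sub>R U q) y z = t * lie_deriv U y z"
proof -
  have r: "metric_diff v a (t *\<^sub>R b) = t * metric_diff v a b" for v a b
    by (metis metric_diff_sym metric_diff_linear(2))
  show "lie_deriv U (t *\<^sub>R y) (t *\<^sub>R y) = t\<^sup>2 * lie_deriv U y y"
    by (simp add: lie_deriv_def center_linear r metric_diff_linear linear_cmul[OF linear_frechet_derivative[OF assms]]
        power2_eq_square algebra_simps)
  have "deriv (\<lambda>q. t *\<^sub>R U q) = (\<lambda>v. t *\<^sub>R deriv U v)"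
    using assms by (intro frechet_derivative_at[symmetric] has_derivative_scaleR_right)
      (simp add: frechet_derivative_works)
  then show "lie_deriv (\<lambda>q. t *\<^sub>R U q) y z = t * lie_deriv U y z"
    by (simp add: lie_deriv_def center_linear metric_diff_linear algebra_simps)
qed

lemma orthogonal_deriv:
  assumes "U differentiable (at q\<^sub>0)" "Z differentiable (at q\<^sub>0)"
    and "\<forall>\<^sub>F q in nhds q\<^sub>0. G q (U q) (Z q) = 0"
  shows "G q\<^sub>0 (deriv U v) (Z q\<^sub>0) = - metric_diff v (U q\<^sub>0) (Z q\<^sub>0) - G q\<^sub>0 (U q\<^sub>0) (deriv Z v)"
proof -
  have "((\<lambda>q. 0) has_derivative (\<lambda>v. metric_diff v (U q\<^sub>0) (Z q\<^sub>0) +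
      G q\<^sub>0 (deriv U v) (Z q\<^sub>0) + G q\<^sub>0 (U q\<^sub>0) (deriv Z v))) (at q\<^sub>0)"
    by (rule has_derivative_eventually_transform[OF product_rule assms(3)])
       (use assms in \<open>auto simp: frechet_derivative_works\<close>)
  from has_derivative_unique[OF this has_derivative_const]
  show ?thesis by (auto simp: fun_eq_iff dest: spec[of _ v])
qed

text \<open>Differentiating \<open>G (U, Z) = 0\<close> expresses the derivative of \<open>U\<close> through its value.\<close>

lemma lie_deriv_cong:
  assumes "U differentiable (at q\<^sub>0)" "U' differentiable (at q\<^sub>0)"
    and "Y differentiable (at q\<^sub>0)" "Z differentiable (at q\<^sub>0)"
    and "U q\<^sub>0 = U' q\<^sub>0"
    and "\<forall>\<^sub>F q in nhds q\<^sub>0. G q (U q) (Y q) = 0" "\<forall>\<^sub>F q in nhds q\<^sub>0. G q (U q) (Z q) = 0"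
    and "\<forall>\<^sub>F q in nhds q\<^sub>0. G q (U' q) (Y q) = 0" "\<forall>\<^sub>F q in nhds q\<^sub>0. G q (U' q) (Z q) = 0"
  shows "lie_deriv U (Y q\<^sub>0) (Z q\<^sub>0) = lie_deriv U' (Y q\<^sub>0) (Z q\<^sub>0)"
  unfolding lie_deriv_def sym[of _ "Y q\<^sub>0"]
  using assms by (simp add: orthogonal_deriv)

text \<open>Differentiating \<alpha>(U) = g(U,U) along W gives \<alpha>(dU W) = (d_W g)(U,U) + 2
  g(U, dU W), while \<alpha> = g(U + W, .) at the base point. Twice the second expression minus the
  first leaves \<alpha>(dU W) = 2 g(W, dU W) - (d_W g)(U,U). Subtracting the same identity with U
  and W exchanged collects the terms of both Lie derivatives.\<close>

lemma lie_deriv_difference: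
  assumes "U differentiable (at q\<^sub>0)" "W differentiable (at q\<^sub>0)" "linear \<alpha>"
    and \<alpha>: "\<And>v. \<alpha> v = G q\<^sub>0 (U q\<^sub>0) v + G q\<^sub>0 (W q\<^sub>0) v"
    and U: "\<forall>\<^sub>F q in nhds q\<^sub>0. G q (U q) (U q) = \<alpha> (U q)"
    and W: "\<forall>\<^sub>F q in nhds q\<^sub>0. G q (W q) (W q) = \<alpha> (W q)"
  shows "\<alpha> (deriv U (W q\<^sub>0)) - \<alpha> (deriv W (U q\<^sub>0)) =
    lie_deriv U (W q\<^sub>0) (W q\<^sub>0) - lie_deriv W (U q\<^sub>0) (U q\<^sub>0)"
proof -
  have *: "metric_diff v (X q\<^sub>0) (X q\<^sub>0) + 2 * G q\<^sub>0 (X q\<^sub>0) (deriv X v) = \<alpha> (deriv X v)"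
    if "X differentiable (at q\<^sub>0)" "\<forall>\<^sub>F q in nhds q\<^sub>0. G q (X q) (X q) = \<alpha> (X q)" for X v
  proof -
    have X: "(X has_derivative deriv X) (at q\<^sub>0)"
      using that(1) frechet_derivative_works by blast
    have "bounded_linear \<alpha>"
      using assms(3) linear_conv_bounded_linear by blast
    then have "((\<lambda>q. \<alpha> (X q)) has_derivative (\<lambda>v. \<alpha> (deriv X v))) (at q\<^sub>0)"
      using X by (rule bounded_linear.has_derivative)
    from has_derivative_unique[OF this has_derivative_eventually_transform[OF product_rule[OF X X] that(2)]]
    have "\<alpha> (deriv X v) = metric_diff v (X q\<^sub>0) (X q\<^sub>0) + G q\<^sub>0 (deriv X v) (X q\<^sub>0) + G q\<^sub>0 (X q\<^sub>0) (deriv X v)"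
      by meson
    then show ?thesis using sym[of q\<^sub>0 "deriv X v"] by simp
  qed
  show ?thesis
    using *[OF assms(1) U, of "W q\<^sub>0"] *[OF assms(2) W, of "U q\<^sub>0"]
      \<alpha>[of "deriv U (W q\<^sub>0)"] \<alpha>[of "deriv W (U q\<^sub>0)"]
      sym[of q\<^sub>0 "deriv U (W q\<^sub>0)"] sym[of q\<^sub>0 "deriv W (U q\<^sub>0)"]
    by (simp add: lie_deriv_def)
qed

end

section \<open>Hamiltonian vector fields and quadratic Hamiltonians in coordinates\<close>

text \<open>Hamilton's equations: the fibre derivative is the velocity, minus the base derivative is
  the force. Uniqueness is nondegeneracy of the form, tested on the vectors
  \<open>(0, \<beta>)\<close> and \<open>(v, 0)\<close>.\<close>

lemma hamiltonian_vector_field_eq: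
  fixes u :: "'e::euclidean_space" and a :: "'e \<Rightarrow>\<^sub>L real"
  assumes "(F has_derivative (\<lambda>\<eta>. blinfun_apply a (fst \<eta>) + blinfun_apply (snd \<eta>) u)) (at z)"
  shows "hamiltonian_vector_field F z = (u, - a)"
proof -
  have F: "frechet_derivative F (at z) = (\<lambda>\<eta>. blinfun_apply a (fst \<eta>) + blinfun_apply (snd \<eta>) u)"
    using frechet_derivative_at[OF assms] by simp
  show ?thesis
    unfolding hamiltonian_vector_field_def F
  proof (rule the_equality)
    show "\<forall>\<eta>. canonical_symplectic z (u, - a) \<eta> = blinfun_apply a (fst \<eta>) + blinfun_apply (snd \<eta>) u"
      by (auto simp: canonical_symplectic_eq blinfun.minus_left)
    fix \<xi> assume \<xi>: "\<forall>\<eta>. canonical_symplectic z \<xi> \<eta> = blinfun_apply a (fst \<eta>) + blinfun_apply (snd \<eta>) u"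
    obtain u' a' where xi: "\<xi> = (u', a')" by (cases \<xi>)
    have e: "blinfun_apply \<beta> u' - blinfun_apply a' v = blinfun_apply a v + blinfun_apply \<beta> u" for v \<beta>
      using \<xi>[rule_format, of "(v, \<beta>)"] by (simp add: xi canonical_symplectic_eq)
    have "u' = u"
      by (rule dual_separates) (use e[of _ 0] in simp)
    moreover have "a' = - a"
      by (rule blinfun_eqI) (use e[of 0] in \<open>simp add: blinfun.minus_left minus_equation_iff eq_commute\<close>)
    ultimately show "\<xi> = (u, - a)" by (simp add: xi)
  qed
qed

text \<open>Local form of a cometric: \<open>e i\<close> are the coordinates of an orthogonal frame
  and \<open>\<gamma> i\<close> its squared lengths. Then \<open>raise\<close> is the sharp map and
  \<open>energy\<close> the Hamiltonian in the cotangent chart.\<close>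

locale diagonal_cometric =
  fixes k :: nat and e :: "nat \<Rightarrow> 'e::euclidean_space \<Rightarrow> 'e" and \<gamma> :: "nat \<Rightarrow> 'e \<Rightarrow> real" and q\<^sub>0 :: 'e
  assumes e: "i < k \<Longrightarrow> e i differentiable (at q\<^sub>0)"
    and \<gamma>: "i < k \<Longrightarrow> \<gamma> i differentiable (at q\<^sub>0)" "i < k \<Longrightarrow> \<gamma> i q\<^sub>0 \<noteq> 0"
begin

definition raise :: "('e \<Rightarrow>\<^sub>L real) \<Rightarrow> 'e \<Rightarrow> 'e" where
  "raise \<alpha> q = (\<Sum>i<k. (blinfun_apply \<alpha> (e i q) / \<gamma> i q) *\<^sub>R e i q)"

definition energy :: "'e \<times> ('e \<Rightarrow>\<^sub>L real) \<Rightarrow> real" where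
  "energy z = 1/2 * blinfun_apply (snd z) (raise (snd z) (fst z))"

lemma raise_differentiable: "raise \<alpha> differentiable (at q\<^sub>0)"
proof -
  have "(\<lambda>q. blinfun_apply \<alpha> (e i q)) differentiable (at q\<^sub>0)" if "i < k" for i
    using e[OF that] bounded_linear.has_derivative[OF blinfun.bounded_linear_right]
    unfolding differentiable_def by blast
  then show ?thesis
    unfolding raise_def[abs_def] using e \<gamma>
    by (intro differentiable_sum differentiable_scaleR differentiable_divide) auto
qed

text \<open>Joint differentiability is visible from the expression by squares, so the derivative is
  the sum of the two partial ones. With \<alpha> fixed, \<open>energy\<close> is half of \<alpha>
  applied to \<open>raise \<alpha>\<close>; with the point fixed it is a quadratic form in the
  covector, whose derivative cancels the factor 1/2.\<close>

lemma energy_has_derivative: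
  "(energy has_derivative (\<lambda>\<eta>. 1/2 * blinfun_apply \<alpha> (frechet_derivative (raise \<alpha>) (at q\<^sub>0) (fst \<eta>)) +
     blinfun_apply (snd \<eta>) (raise \<alpha> q\<^sub>0))) (at (q\<^sub>0, \<alpha>))"
proof -
  have en: "energy = (\<lambda>z. 1/2 * (\<Sum>i<k. (blinfun_apply (snd z) (e i (fst z)))\<^sup>2 / \<gamma> i (fst z)))"
    by (simp add: fun_eq_iff energy_def raise_def blinfun.sum_right blinfun.scaleR_right power2_eq_square)
  have fst: "(\<lambda>z. f (fst z)) differentiable (at (q\<^sub>0, \<alpha>))" if "f differentiable (at q\<^sub>0)"
    for f :: "'e \<Rightarrow> 'c::real_normed_vector"
  proof -
    from that obtain f' where "(f has_derivative f') (at (fst (q\<^sub>0, \<alpha>)))"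
      by (auto simp: differentiable_def)
    from has_derivative_compose[OF has_derivative_fst[OF has_derivative_ident] this]
    show ?thesis by (auto simp: differentiable_def)
  qed
  have d3: "(\<lambda>z. blinfun_apply (snd z) (e i (fst z))) differentiable (at (q\<^sub>0, \<alpha>))" if i: "i < k" for i
    using blinfun.FDERIV[OF has_derivative_snd[OF has_derivative_ident] fst[OF e[OF i], unfolded frechet_derivative_works]]
    by (auto simp: differentiable_def)
  have "energy differentiable (at (q\<^sub>0, \<alpha>))"
    unfolding en power2_eq_square
  proof (intro differentiable_mult differentiable_sum differentiable_const ballI)
    fix i assume "i \<in> {..<k}"
    then show "(\<lambda>z. blinfun_apply (snd z) (e i (fst z)) * blinfun_apply (snd z) (e i (fst z)) / \<gamma> i (fst z))
        differentiable (at (q\<^sub>0, \<alpha>))"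
      using \<gamma> fst[of "\<gamma> i"] d3[of i] by (intro differentiable_divide differentiable_mult) auto
  qed auto
  then obtain E where E: "(energy has_derivative E) (at (q\<^sub>0, \<alpha>))"
    by (auto simp: differentiable_def)
  have "((\<lambda>q. energy (q, \<alpha>)) has_derivative (\<lambda>v. E (v, 0))) (at q\<^sub>0)"
    by (rule has_derivative_compose[of "\<lambda>q. (q, \<alpha>)", OF _ E]) (auto intro!: derivative_eq_intros)
  moreover have "((\<lambda>q. energy (q, \<alpha>)) has_derivative
      (\<lambda>v. 1/2 * blinfun_apply \<alpha> (frechet_derivative (raise \<alpha>) (at q\<^sub>0) v))) (at q\<^sub>0)"
    unfolding energy_def fst_conv snd_conv using raise_differentiable[of \<alpha>]
    by (intro has_derivative_mult_right bounded_linear.has_derivative[OF blinfun.bounded_linear_right])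
       (simp add: frechet_derivative_works)
  ultimately have E1: "E (v, 0) = 1/2 * blinfun_apply \<alpha> (frechet_derivative (raise \<alpha>) (at q\<^sub>0) v)" for v
    using has_derivative_unique by metis
  have "((\<lambda>\<beta>. energy (q\<^sub>0, \<beta>)) has_derivative (\<lambda>\<beta>. E (0, \<beta>))) (at \<alpha>)"
    by (rule has_derivative_compose[of "\<lambda>\<beta>. (q\<^sub>0, \<beta>)", OF _ E]) (auto intro!: derivative_eq_intros)
  moreover have "((\<lambda>\<beta>. energy (q\<^sub>0, \<beta>)) has_derivative (\<lambda>\<beta>. blinfun_apply \<beta> (raise \<alpha> q\<^sub>0))) (at \<alpha>)"
  proof -
    have "((\<lambda>\<beta>. blinfun_apply \<beta> (e i q\<^sub>0) * blinfun_apply \<beta> (e i q\<^sub>0) / \<gamma> i q\<^sub>0) has_derivative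
        (\<lambda>\<beta>. (blinfun_apply \<alpha> (e i q\<^sub>0) * blinfun_apply \<beta> (e i q\<^sub>0) + blinfun_apply \<beta> (e i q\<^sub>0) * blinfun_apply \<alpha> (e i q\<^sub>0)) / \<gamma> i q\<^sub>0)) (at \<alpha>)" for i
      by (intro bounded_linear.has_derivative[OF bounded_linear_divide] has_derivative_mult
          bounded_linear.has_derivative[OF blinfun.bounded_linear_left] has_derivative_ident)
    then have "((\<lambda>\<beta>. energy (q\<^sub>0, \<beta>)) has_derivative (\<lambda>\<beta>. 1/2 * (\<Sum>i<k.
        (blinfun_apply \<alpha> (e i q\<^sub>0) * blinfun_apply \<beta> (e i q\<^sub>0) + blinfun_apply \<beta> (e i q\<^sub>0) * blinfun_apply \<alpha> (e i q\<^sub>0)) / \<gamma> i q\<^sub>0))) (at \<alpha>)"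
      unfolding en fst_conv snd_conv power2_eq_square
      by (intro has_derivative_mult_right has_derivative_sum)
    moreover have "(\<lambda>\<beta>. 1/2 * (\<Sum>i<k. (blinfun_apply \<alpha> (e i q\<^sub>0) * blinfun_apply \<beta> (e i q\<^sub>0) +
        blinfun_apply \<beta> (e i q\<^sub>0) * blinfun_apply \<alpha> (e i q\<^sub>0)) / \<gamma> i q\<^sub>0)) = (\<lambda>\<beta>. blinfun_apply \<beta> (raise \<alpha> q\<^sub>0))"
      by (rule ext) (simp add: raise_def blinfun.sum_right blinfun.scaleR_right sum_distrib_left mult.commute)
    ultimately show ?thesis by simp
  qed
  ultimately have E2: "E (0, \<beta>) = blinfun_apply \<beta> (raise \<alpha> q\<^sub>0)" for \<beta>
    using has_derivative_unique by metis
  have "E = (\<lambda>\<eta>. 1/2 * blinfun_apply \<alpha> (frechet_derivative (raise \<alpha>) (at q\<^sub>0) (fst \<eta>)) +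
     blinfun_apply (snd \<eta>) (raise \<alpha> q\<^sub>0))"
  proof
    fix \<eta> :: "'e \<times> ('e \<Rightarrow>\<^sub>L real)"
    have "E \<eta> = E (fst \<eta>, 0) + E (0, snd \<eta>)"
      by (simp flip: linear_add[OF has_derivative_linear[OF E]])
    then show "E \<eta> = 1/2 * blinfun_apply \<alpha> (frechet_derivative (raise \<alpha>) (at q\<^sub>0) (fst \<eta>)) +
      blinfun_apply (snd \<eta>) (raise \<alpha> q\<^sub>0)"
      by (simp add: E1 E2)
  qed
  then show ?thesis using E by simp
qed

end

section \<open>The metric, its Lie derivatives and the sharp maps in the chart at a point\<close>

context smooth_atlas
begin

lemma eventually_nhds_chart:
  assumes "c \<in> A" "open U" "x \<in> U" "x \<in> fst c" "\<And>y. y \<in> fst c \<Longrightarrow> y \<in> U \<Longrightarrow> P (snd c y)"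
  shows "\<forall>\<^sub>F q in nhds (snd c x). P q"
  using eventually_chart_inv[OF assms(1-4)] by (rule eventually_mono) (use assms(5) in force)

lemma field_in_chart_snd [simp]:
  "c \<in> A \<Longrightarrow> y \<in> fst c \<Longrightarrow> field_in_chart A c X (snd c y) = tangent_coord A c y (X y)"
  by (simp add: field_in_chart_def)

lemma coord_field_chart_at [simp]: "coord_field (chart_at A x) a x = a"
  by (simp add: coord_field_def)

end

context riemannian_atlas
begin

definition chart_metric :: "('m, 'e) chart \<Rightarrow> 'e \<Rightarrow> 'e \<Rightarrow> 'e \<Rightarrow> real" where
  "chart_metric c q a b = (let y = chart_inv c q in g y (coord_field c a y) (coord_field c b y))"

lemma chart_metric_snd:
  "c \<in> A \<Longrightarrow> y \<in> fst c \<Longrightarrow> chart_metric c (snd c y) a b = g y (coord_field c a y) (coord_field c b y)"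
  by (simp add: chart_metric_def)

lemma metric_germ_chart_metric:
  assumes "c \<in> A" "x \<in> fst c"
  shows "metric_germ (chart_metric c) (snd c x)"
proof
  show "chart_metric c q a b = chart_metric c q b a" for q a b
    by (simp add: chart_metric_def metricD(2))
  have "bilinear (chart_metric c (snd c y))" if "y \<in> fst c" for y
    using linear_coord_field[OF assms(1) that] metricD(1)[of y]
    unfolding bilinear_def chart_metric_snd[OF assms(1) that]
    by (auto intro: linear_compose[unfolded comp_def, of "\<lambda>a. coord_field c a y" "g y _"]
        linear_compose[unfolded comp_def, of "\<lambda>a. coord_field c a y" "\<lambda>u. g y u _"])
  then show "\<forall>\<^sub>F q in nhds (snd c x). bilinear (chart_metric c q)"
    by (intro eventually_nhds_chart[OF assms(1) open_UNIV UNIV_I assms(2)]) auto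
  show "(\<lambda>q. chart_metric c q a b) differentiable (at (snd c x))" for a b
    unfolding chart_metric_def Let_def
    by (rule fun_in_chart_differentiable[OF smooth_fun_on_metric[OF chart_props(1)] assms(1,2)])
       (use assms smooth_field_on_coord_field in auto)
qed

abbreviation lie_form :: "'m \<Rightarrow> ('e \<Rightarrow> 'e) \<Rightarrow> 'e \<Rightarrow> 'e \<Rightarrow> real" where
  "lie_form x \<equiv> metric_germ.lie_deriv (chart_metric (chart_at A x)) (snd (chart_at A x) x)"

text \<open>Connects the invariant formula for the Lie derivative with its coordinate version. In
  \<open>chart_at A x\<close> the coordinates of a field at \<open>x\<close> are its value, so only
  the function g(Y,Z) has to be rewritten, and that on a neighbourhood because it is
  differentiated.\<close>

lemma lie_form_eq:
  assumes "vector_field A X" "vector_field A Y" "vector_field A Z"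
  shows "field_deriv A X (\<lambda>y. g y (Y y) (Z y)) x - g x (lie_bracket A X Y x) (Z x) - g x (Y x) (lie_bracket A X Z x) =
    lie_form x (field_in_chart A (chart_at A x) X) (Y x) (Z x)"
proof -
  define c where "c = chart_at A x"
  have c: "c \<in> A" "x \<in> fst c" by (simp_all add: c_def)
  interpret metric_germ "chart_metric c" "snd c x"
    using metric_germ_chart_metric[OF c] .
  have d: "field_in_chart A c W differentiable (at (snd c x))" if "vector_field A W" for W
    using field_in_chart_differentiable[OF _ c] that unfolding vector_field_def by blast
  have v: "field_in_chart A c W (snd c x) = W x" for W
    by (simp add: c_def)
  have m: "chart_metric c (snd c x) a b = g x a b" for a b
    by (simp add: chart_metric_snd[OF c]) (simp add: c_def)
  have "\<forall>\<^sub>F q in nhds (snd c x). chart_metric c q (field_in_chart A c Y q) (field_in_chart A c Z q) =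
      (\<lambda>q. g (chart_inv c q) (Y (chart_inv c q)) (Z (chart_inv c q))) q"
    by (rule eventually_nhds_chart[OF c(1) open_UNIV UNIV_I c(2)]) (simp add: chart_metric_snd c(1))
  then have "frechet_derivative (\<lambda>q. g (chart_inv c q) (Y (chart_inv c q)) (Z (chart_inv c q))) (at (snd c x)) =
      frechet_derivative (\<lambda>q. chart_metric c q (field_in_chart A c Y q) (field_in_chart A c Z q)) (at (snd c x))"
    using frechet_derivative_at[OF has_derivative_eventually_transform[OF
        product_rule[OF d[OF assms(2), unfolded frechet_derivative_works] d[OF assms(3), unfolded frechet_derivative_works]]]]
      frechet_derivative_at[OF
        product_rule[OF d[OF assms(2), unfolded frechet_derivative_works] d[OF assms(3), unfolded frechet_derivative_works]]]
    by simp
  then show ?thesis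
    using lie_deriv_eq_bracket[OF d[OF assms(2)] d[OF assms(3)], of "field_in_chart A c X"]
    unfolding v m field_deriv_def lie_bracket_def Let_def comp_def c_def[symmetric] by simp
qed

text \<open>A relation, so that representatives from different frames, or obtained by subtraction,
  are compared by uniqueness alone.\<close>

definition is_riesz :: "('m \<Rightarrow> 'e set) \<Rightarrow> 'm \<Rightarrow> ('e \<Rightarrow> real) \<Rightarrow> 'e \<Rightarrow> bool" where
  "is_riesz E y p u \<longleftrightarrow> u \<in> E y \<and> (\<forall>w\<in>E y. g y u w = p w)"

lemma is_riesz_unique: "subspace (E y) \<Longrightarrow> is_riesz E y p u \<Longrightarrow> is_riesz E y p v \<Longrightarrow> u = v"
  unfolding is_riesz_def using inner_form_eqI[OF inner_form_metric] by metis

lemma hamiltonian_eq: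
  assumes "subspace (E y)" "\<And>u v. u \<in> E y \<Longrightarrow> v \<in> E y \<Longrightarrow> s y u v = g y u v"
    and "\<And>p. linear p \<Longrightarrow> \<exists>u. is_riesz E y p u" and "is_riesz E y (blinfun_apply p) u"
  shows "hamiltonian E s (y, p) = 1/2 * blinfun_apply p u"
proof -
  have "\<exists>r. \<forall>p. is_riesz E y (blinfun_apply p) (r p)"
    using assms(3) by (intro choice) (auto simp: bounded_linear.linear blinfun.bounded_linear_right)
  then obtain r where r: "\<And>p. is_riesz E y (blinfun_apply p) (r p)" by blast
  have "cometric E s y p p = blinfun_apply p (r p)"
    by (rule cometric_eq[OF inner_form_metric[of y]]) (use r assms(1,2) in \<open>auto simp: is_riesz_def\<close>)
  moreover have "r p = u"
    using is_riesz_unique[OF assms(1) r assms(4)] .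
  ultimately show ?thesis by (simp add: hamiltonian_def)
qed

text \<open>\<open>R \<alpha>\<close> is, in the chart at \<open>x\<close> and near \<open>x\<close>, the section of \<open>E\<close> dual to the covector field with
  constant coordinates \<open>\<alpha>\<close>. The last conjunct is the derivative of the Hamiltonian $\frac12\alpha(R_\alpha)$
  on the cotangent bundle.\<close>

definition sharp_germ :: "('m \<Rightarrow> 'e set) \<Rightarrow> 'm \<Rightarrow> (('e \<Rightarrow>\<^sub>L real) \<Rightarrow> 'e \<Rightarrow> 'e) \<Rightarrow> bool" where
  "sharp_germ E x R \<longleftrightarrow> (let c = chart_at A x; q\<^sub>0 = snd c x in
     (\<forall>\<alpha>. R \<alpha> differentiable (at q\<^sub>0)) \<and>
     (\<forall>\<^sub>F q in nhds q\<^sub>0. \<forall>\<alpha>. is_riesz E (chart_inv c q)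
        (\<lambda>w. blinfun_apply \<alpha> (tangent_coord A c (chart_inv c q) w)) (coord_field c (R \<alpha> q) (chart_inv c q))) \<and>
     (\<forall>\<alpha>. ((\<lambda>z. 1/2 * blinfun_apply (snd z) (R (snd z) (fst z))) has_derivative
        (\<lambda>\<eta>. 1/2 * blinfun_apply \<alpha> (frechet_derivative (R \<alpha>) (at q\<^sub>0) (fst \<eta>)) +
          blinfun_apply (snd \<eta>) (R \<alpha> q\<^sub>0))) (at (q\<^sub>0, \<alpha>))))"

text \<open>In the cotangent chart the Hamiltonian coincides near the base point with the explicit
  expression in \<open>R\<close> whose derivative \<open>sharp_germ\<close> records.\<close>

lemma sharp_germ_hamiltonian:
  assumes R: "sharp_germ E x R" and E: "\<And>y. subspace (E y)"
    and s: "\<And>y u v. u \<in> E y \<Longrightarrow> v \<in> E y \<Longrightarrow> s y u v = g y u v"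
    and ex: "\<And>y p. linear p \<Longrightarrow> \<exists>u. is_riesz E y p u"
  shows "((hamiltonian E s \<circ> cotangent_chart_inv A (chart_at A x)) has_derivative
     (\<lambda>\<eta>. 1/2 * blinfun_apply \<alpha> (frechet_derivative (R \<alpha>) (at (snd (chart_at A x) x)) (fst \<eta>)) +
          blinfun_apply (snd \<eta>) (R \<alpha> (snd (chart_at A x) x)))) (at (snd (chart_at A x) x, \<alpha>))"
proof -
  define c where "c = chart_at A x"
  have c: "c \<in> A" "x \<in> fst c" by (simp_all add: c_def)
  note R = R[unfolded sharp_germ_def Let_def, folded c_def]
  have "\<forall>\<^sub>F q in nhds (snd c x). \<forall>\<alpha>. 1/2 * blinfun_apply \<alpha> (R \<alpha> q) =
      (hamiltonian E s \<circ> cotangent_chart_inv A c) (q, \<alpha>)"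
    using R[THEN conjunct2, THEN conjunct1] eventually_chart_inv[OF c(1) open_UNIV UNIV_I c(2)]
  proof eventually_elim
    case (elim q)
    show ?case
    proof
      fix \<alpha> :: "'e \<Rightarrow>\<^sub>L real"
      let ?y = "chart_inv c q"
      have y: "?y \<in> fst c" "snd c ?y = q" using elim(2) by auto
      have app: "blinfun_apply (\<alpha> o\<^sub>L Blinfun (tangent_coord A c ?y)) w = blinfun_apply \<alpha> (tangent_coord A c ?y w)" for w
        using linear_tangent_coord[OF c(1) y(1)]
        by (simp add: bounded_linear_Blinfun_apply linear_conv_bounded_linear)
      have "is_riesz E ?y (blinfun_apply (\<alpha> o\<^sub>L Blinfun (tangent_coord A c ?y))) (coord_field c (R \<alpha> q) ?y)"
        using elim(1) unfolding is_riesz_def app by blast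
      then have "hamiltonian E s (?y, \<alpha> o\<^sub>L Blinfun (tangent_coord A c ?y)) =
          1/2 * blinfun_apply \<alpha> (tangent_coord A c ?y (coord_field c (R \<alpha> q) ?y))"
        using hamiltonian_eq[where E = E and s = s and y = ?y, OF E s ex] app by metis
      then show "1/2 * blinfun_apply \<alpha> (R \<alpha> q) = (hamiltonian E s \<circ> cotangent_chart_inv A c) (q, \<alpha>)"
        using c y by (simp add: cotangent_chart_inv_def Let_def tangent_coord_coord_field)
    qed
  qed
  \<comment> \<open>The identity holds for all covectors at once when \<open>q\<close> is near the
    base point, so pulling it back along \<open>fst\<close> gives a neighbourhood in the cotangent
    chart.\<close>
  moreover have "filterlim fst (nhds (snd c x)) (nhds (snd c x, \<alpha>))"
    using tendsto_fst[OF filterlim_ident[of "nhds (snd c x, \<alpha>)"]] by simp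
  ultimately have "\<forall>\<^sub>F z in nhds (snd c x, \<alpha>). \<forall>\<alpha>. 1/2 * blinfun_apply \<alpha> (R \<alpha> (fst z)) =
      (hamiltonian E s \<circ> cotangent_chart_inv A c) (fst z, \<alpha>)"
    by (rule eventually_compose_filterlim)
  then have "\<forall>\<^sub>F z in nhds (snd c x, \<alpha>). 1/2 * blinfun_apply (snd z) (R (snd z) (fst z)) =
      (hamiltonian E s \<circ> cotangent_chart_inv A c) z"
    by (rule eventually_mono) simp
  then show ?thesis
    using R[THEN conjunct2, THEN conjunct2, rule_format, of \<alpha>] unfolding c_def[symmetric]
    by (rule has_derivative_eventually_transform[rotated])
qed

lemma ex_is_riesz:
  assumes "subbundle A E" "linear p"
  shows "\<exists>u. is_riesz E y p u"
proof -
  obtain k and e :: "nat \<Rightarrow> 'm \<Rightarrow> 'e" where o: "orthogonal_basis (g y) k (\<lambda>i. e i y) (E y)"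
    using orthogonal_frame[OF assms(1), of y] by metis
  show ?thesis
    using riesz_vec[OF inner_form_metric o] assms(2) unfolding is_riesz_def by blast
qed

text \<open>By linearity of \<open>tangent_coord\<close>, \<open>raise\<close> formed from the
  coordinates of an orthogonal frame is the coordinate expression of \<open>riesz_vec\<close>, which
  identifies it as the dual section.\<close>

lemma ex_sharp_germ:
  assumes "subbundle A E"
  shows "\<exists>R. sharp_germ E x R"
proof -
  define c where "c = chart_at A x"
  have c: "c \<in> A" "x \<in> fst c" by (simp_all add: c_def)
  obtain U k e where U: "open U" "x \<in> U" and e: "\<And>i. i < k \<Longrightarrow> smooth_field_on A U (e i)"
    and o: "\<And>y. y \<in> U \<Longrightarrow> orthogonal_basis (g y) k (\<lambda>i. e i y) (E y)"
    using orthogonal_frame[OF assms, of x] by metis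
  define \<gamma> where "\<gamma> = (\<lambda>i q. g (chart_inv c q) (e i (chart_inv c q)) (e i (chart_inv c q)))"
  interpret diagonal_cometric k "\<lambda>i. field_in_chart A c (e i)" \<gamma> "snd c x"
  proof
    fix i assume i: "i < k"
    show "field_in_chart A c (e i) differentiable (at (snd c x))"
      using field_in_chart_differentiable[OF e[OF i] c U(2)] .
    show "\<gamma> i differentiable (at (snd c x))"
      unfolding \<gamma>_def
      by (rule fun_in_chart_differentiable[OF smooth_fun_on_metric[OF U(1) e[OF i] e[OF i]] c U(2)])
    show "\<gamma> i (snd c x) \<noteq> 0"
      using o[OF U(2)] i c metricD(5) by (auto simp: \<gamma>_def orthogonal_basis_def)
  qed
  have "is_riesz E y (\<lambda>w. blinfun_apply \<alpha> (tangent_coord A c y w)) (coord_field c (raise \<alpha> (snd c y)) y)"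
    if y: "y \<in> fst c" "y \<in> U" for y \<alpha>
  proof -
    let ?p = "\<lambda>w. blinfun_apply \<alpha> (tangent_coord A c y w)"
    have T: "linear (tangent_coord A c y)"
      using linear_tangent_coord c(1) y(1) .
    have "raise \<alpha> (snd c y) = tangent_coord A c y (riesz_vec (g y) k (\<lambda>i. e i y) ?p)"
      unfolding raise_def riesz_vec_def
      using c y by (simp add: \<gamma>_def linear_sum[OF T] linear_cmul[OF T])
    moreover have "linear ?p"
      using linear_compose[OF T bounded_linear.linear[OF blinfun.bounded_linear_right]] by (simp add: comp_def)
    ultimately show ?thesis
      using riesz_vec[OF inner_form_metric o[OF y(2)]] c y by (auto simp: is_riesz_def)
  qed
  then have "\<forall>\<^sub>F q in nhds (snd c x). \<forall>\<alpha>. is_riesz E (chart_inv c q)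
        (\<lambda>w. blinfun_apply \<alpha> (tangent_coord A c (chart_inv c q) w)) (coord_field c (raise \<alpha> q) (chart_inv c q))"
    using c by (intro eventually_nhds_chart[OF c(1) U c(2)]) auto
  then have "sharp_germ E x raise"
    using raise_differentiable energy_has_derivative
    unfolding sharp_germ_def Let_def c_def[symmetric] energy_def[abs_def] by blast
  then show ?thesis by (rule exI[of _ raise])
qed

end

section \<open>The orthogonal splitting\<close>

locale riemannian_splitting = riemannian_atlas A g
  for A :: "('m::{t2_space,second_countable_topology}, 'e::euclidean_space) chart set" and g +
  fixes H V :: "'m \<Rightarrow> 'e set"
  assumes subbundle_H: "subbundle A H" and V: "V = orth_complement g H"
begin

lemma V_iff: "v \<in> V y \<longleftrightarrow> (\<forall>u\<in>H y. g y u v = 0)"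
  by (simp add: V orth_complement_def)

lemma orthogonal: "u \<in> H y \<Longrightarrow> w \<in> V y \<Longrightarrow> g y u w = 0" "u \<in> H y \<Longrightarrow> w \<in> V y \<Longrightarrow> g y w u = 0"
  using metricD(2) by (auto simp: V_iff)

lemmas metric_linear = bilinear_ladd[OF metricD(1)] bilinear_radd[OF metricD(1)]
  bilinear_lsub[OF metricD(1)] bilinear_rsub[OF metricD(1)]
  bilinear_lmul[OF metricD(1)] bilinear_rmul[OF metricD(1)]

lemma subspace_H: "subspace (H y)"
  using subspace_subbundle[OF subbundle_H] .

lemma subspace_V: "subspace (V y)"
  by (rule subspaceI) (auto simp: V_iff metric_linear linear_0[OF metricD(6)])

lemma pr_H: "pr g H X y \<in> H y" "w \<in> H y \<Longrightarrow> g y (pr g H X y) w = g y (X y) w"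
  using pr_props[OF subbundle_H] by auto

lemma pr_V_eq: "pr g V X = (\<lambda>y. X y - pr g H X y)"
proof
  fix y
  show "pr g V X y = X y - pr g H X y"
  proof (rule pr_eqI)
    show "X y - pr g H X y \<in> V y"
      using pr_H(2)[of _ y X] metricD(2)[of y] by (auto simp: V_iff metric_linear)
    show "g y (X y) w = g y (X y - pr g H X y) w" if "w \<in> V y" for w
      using orthogonal[OF pr_H(1) that] by (simp add: metric_linear)
  qed (simp_all add: inner_form_metric subspace_V)
qed

lemma pr_V: "pr g V X y \<in> V y" "w \<in> V y \<Longrightarrow> g y (pr g V X y) w = g y (X y) w"
proof -
  show "pr g V X y \<in> V y"
    using pr_H(2)[of _ y X] metricD(2)[of y] by (auto simp: V_iff metric_linear pr_V_eq)
  show "w \<in> V y \<Longrightarrow> g y (pr g V X y) w = g y (X y) w"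
    using orthogonal[OF pr_H(1)] by (simp add: metric_linear pr_V_eq)
qed

lemma pr_H_id: "X y \<in> H y \<Longrightarrow> pr g H X y = X y"
  by (rule inner_form_eqI[OF inner_form_metric[of y] subspace_H]) (auto simp: pr_H)

lemma pr_V_id: "X y \<in> V y \<Longrightarrow> pr g V X y = X y"
  by (rule inner_form_eqI[OF inner_form_metric[of y] subspace_V]) (auto simp: pr_V)

lemma vector_field_pr:
  assumes "vector_field A X"
  shows "vector_field A (pr g H X)" "vector_field A (pr g V X)"
  using smooth_field_on_pr[OF subbundle_H assms] assms
  unfolding pr_V_eq vector_field_def by (auto intro: smooth_field_on_diff)

text \<open>Self-adjointness of the projections. The vector \<open>w\<close> enters as a constant
  function, which is harmless since \<open>pr\<close> looks only at the value at
  \<open>y\<close>.\<close>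

lemma metric_pr:
  "g y (pr g H X y) w = g y (X y) (pr g H (\<lambda>_. w) y)" "g y (pr g V X y) w = g y (X y) (pr g V (\<lambda>_. w) y)"
proof -
  have "g y (pr g H X y) w = g y (pr g H (\<lambda>_. w) y) (pr g H X y)"
    using pr_H(2)[where X = "\<lambda>_. w", OF pr_H(1)] by (simp add: metricD(2)[of y _ w])
  also have "\<dots> = g y (X y) (pr g H (\<lambda>_. w) y)"
    using pr_H(2)[where X = X, OF pr_H(1)] by (simp add: metricD(2)[of y _ "pr g H X y"])
  finally show "g y (pr g H X y) w = g y (X y) (pr g H (\<lambda>_. w) y)" .
  have "g y (pr g V X y) w = g y (pr g V (\<lambda>_. w) y) (pr g V X y)"
    using pr_V(2)[where X = "\<lambda>_. w", OF pr_V(1)] by (simp add: metricD(2)[of y _ w])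
  also have "\<dots> = g y (X y) (pr g V (\<lambda>_. w) y)"
    using pr_V(2)[where X = X, OF pr_V(1)] by (simp add: metricD(2)[of y _ "pr g V X y"])
  finally show "g y (pr g V X y) w = g y (X y) (pr g V (\<lambda>_. w) y)" .
qed

text \<open>Both representatives pair with vectors of \<open>H y\<close> in the same way, so their
  difference is orthogonal to \<open>H y\<close>; against vectors of \<open>V y\<close> the part
  \<open>u\<close> contributes nothing.\<close>

lemma is_riesz_V:
  assumes u: "is_riesz H y p u" and u': "is_riesz (\<lambda>_. UNIV) y p u'"
  shows "is_riesz V y p (u' - u)"
  unfolding is_riesz_def V_iff
proof (intro conjI ballI)
  show "g y a (u' - u) = 0" if "a \<in> H y" for a
  proof -
    have "g y a (u' - u) = g y u' a - g y u a"
      by (simp add: metric_linear(4) metricD(2)[of y a])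
    then show ?thesis using that u u' by (simp add: is_riesz_def)
  qed
  show "g y (u' - u) w = p w" if "w \<in> V y" for w
    using that u u' orthogonal(1)[of u y w] by (simp add: is_riesz_def metric_linear(3))
qed

text \<open>The germ for \<open>V\<close> is the one for the whole tangent bundle minus the one for
  \<open>H\<close>, which avoids building a frame of \<open>V\<close>. All three requirements
  survive subtraction: differentiability, duality by \<open>is_riesz_V\<close>, and the derivative
  formula, which is linear in the germ.\<close>

lemma ex_sharp_germ_splitting:
  obtains R S where "sharp_germ H x R" "sharp_germ V x S"
proof -
  obtain R where R: "sharp_germ H x R"
    using ex_sharp_germ[OF subbundle_H] by blast
  obtain T where T: "sharp_germ (\<lambda>_. UNIV) x T"
    using ex_sharp_germ[OF subbundle_UNIV] by blast
  define c where "c = chart_at A x"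
  have c: "c \<in> A" "x \<in> fst c" by (simp_all add: c_def)
  note R' = R[unfolded sharp_germ_def Let_def, folded c_def]
  note T' = T[unfolded sharp_germ_def Let_def, folded c_def]
  define S where "S = (\<lambda>\<alpha> q. T \<alpha> q - R \<alpha> q)"
  have "S \<alpha> differentiable (at (snd c x))" for \<alpha>
    unfolding S_def using R' T' by (intro differentiable_diff) auto
  moreover have "\<forall>\<^sub>F q in nhds (snd c x). \<forall>\<alpha>. is_riesz V (chart_inv c q)
        (\<lambda>w. blinfun_apply \<alpha> (tangent_coord A c (chart_inv c q) w)) (coord_field c (S \<alpha> q) (chart_inv c q))"
    using R'[THEN conjunct2, THEN conjunct1] T'[THEN conjunct2, THEN conjunct1]
      eventually_chart_inv[OF c(1) open_UNIV UNIV_I c(2)]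
  proof eventually_elim
    case (elim q)
    then have "coord_field c (S \<alpha> q) (chart_inv c q) =
        coord_field c (T \<alpha> q) (chart_inv c q) - coord_field c (R \<alpha> q) (chart_inv c q)" for \<alpha>
      unfolding S_def using linear_diff[OF linear_coord_field[OF c(1)]] by auto
    with elim(1,2) show ?case
      using is_riesz_V by simp
  qed
  moreover have "((\<lambda>z. 1/2 * blinfun_apply (snd z) (S (snd z) (fst z))) has_derivative
        (\<lambda>\<eta>. 1/2 * blinfun_apply \<alpha> (frechet_derivative (S \<alpha>) (at (snd c x)) (fst \<eta>)) +
          blinfun_apply (snd \<eta>) (S \<alpha> (snd c x)))) (at (snd c x, \<alpha>))" for \<alpha>
  proof -
    have "(R \<alpha> has_derivative frechet_derivative (R \<alpha>) (at (snd c x))) (at (snd c x))"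
      "(T \<alpha> has_derivative frechet_derivative (T \<alpha>) (at (snd c x))) (at (snd c x))"
      using R' T' by (auto simp: frechet_derivative_works)
    from frechet_derivative_at[OF has_derivative_diff[OF this(2,1)]]
    have "frechet_derivative (S \<alpha>) (at (snd c x)) =
        (\<lambda>v. frechet_derivative (T \<alpha>) (at (snd c x)) v - frechet_derivative (R \<alpha>) (at (snd c x)) v)"
      by (simp add: S_def)
    then show ?thesis
      using has_derivative_diff[OF T'[THEN conjunct2, THEN conjunct2, rule_format, of \<alpha>] R'[THEN conjunct2, THEN conjunct2, rule_format, of \<alpha>]]
      by (simp add: S_def blinfun.diff_right algebra_simps diff_divide_distrib)
  qed
  ultimately have "sharp_germ V x S"
    unfolding sharp_germ_def Let_def c_def by blast
  with R that show ?thesis by blast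
qed

lemma ex_is_riesz_V:
  assumes "linear p"
  shows "\<exists>u. is_riesz V y p u"
proof -
  obtain u u' where "is_riesz H y p u" "is_riesz (\<lambda>_. UNIV) y p u'"
    using ex_is_riesz[OF subbundle_H assms] ex_is_riesz[OF subbundle_UNIV assms] by blast
  then have "is_riesz V y p (u' - u)"
    by (rule is_riesz_V)
  then show ?thesis ..
qed

lemma riesz_sum:
  assumes "is_riesz H y p u" "is_riesz V y p w" "linear p"
  shows "p v = g y u v + g y w v"
proof -
  let ?h = "pr g H (\<lambda>_. v) y" and ?v = "pr g V (\<lambda>_. v) y"
  have v: "v = ?h + ?v" by (simp add: pr_V_eq)
  have "p (?h + ?v) = g y u (?h + ?v) + g y w (?h + ?v)"
    using assms orthogonal[of _ y] pr_H(1) pr_V(1)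
    by (auto simp: is_riesz_def metric_linear linear_add)
  then show ?thesis using v by simp
qed

end

section \<open>The covariant derivative of the metric under the modified connection\<close>

context smooth_atlas
begin

lemma field_deriv_add:
  assumes "smooth_fun_on A UNIV f" "smooth_fun_on A UNIV f'"
  shows "field_deriv A X (\<lambda>y. f y + f' y) x = field_deriv A X f x + field_deriv A X f' x"
proof -
  have "((\<lambda>q. f (chart_inv (chart_at A x) q)) has_derivative
      frechet_derivative (\<lambda>q. f (chart_inv (chart_at A x) q)) (at (snd (chart_at A x) x))) (at (snd (chart_at A x) x))"
    if "smooth_fun_on A UNIV f" for f
    using fun_in_chart_differentiable[OF that] by (simp add: frechet_derivative_works)
  from frechet_derivative_at[OF has_derivative_add[OF this[OF assms(1)] this[OF assms(2)]]]
  show ?thesis by (simp add: field_deriv_def comp_def fun_eq_iff)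
qed

lemma field_deriv_field_add:
  assumes "smooth_fun_on A UNIV f" "X x = Y x + Z x"
  shows "field_deriv A X f x = field_deriv A Y f x + field_deriv A Z f x"
  using fun_in_chart_differentiable[OF assms(1), of "chart_at A x" x]
  by (simp add: field_deriv_def comp_def assms(2) linear_add[OF linear_frechet_derivative])

end

context riemannian_splitting
begin

lemma pr_const: "pr g E (\<lambda>_. X y) y = pr g E X y"
  by (simp add: pr_def)

lemma metric_pr_field:
  "g y (pr g H X y) (Z y) = g y (X y) (pr g H Z y)" "g y (pr g V X y) (Z y) = g y (X y) (pr g V Z y)"
  by (simp_all add: metric_pr pr_const)

lemma metric_decompose: "g y (X y) (Y y) = g y (pr g H X y) (pr g H Y y) + g y (pr g V X y) (pr g V Y y)"
proof -
  have "g y (X y) (Y y) = g y (X y) (pr g H Y y) + g y (X y) (pr g V Y y)"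
    by (simp add: pr_V_eq metric_linear)
  then show ?thesis
    using pr_H pr_V by simp
qed

lemma metric_ring_connection:
  "g x (ring_connection A g H V D X Y x) (Z x) =
     g x (D (pr g H X) (pr g H Y) x) (pr g H Z x) + g x (D (pr g V X) (pr g V Y) x) (pr g V Z x) +
     g x (lie_bracket A (pr g V X) (pr g H Y) x) (pr g H Z x) +
     g x (lie_bracket A (pr g H X) (pr g V Y) x) (pr g V Z x)"
  by (simp add: ring_connection_def metric_linear metric_pr_field)

text \<open>The mixed products in g(Y,Z) vanish, leaving an H part and a V part, and X splits
  likewise. Metric compatibility of \<open>D\<close> cancels X_H acting on the H part against the
  terms in \<open>D\<close>, and X_V acting on the V part. What remains is X_V on the H part and X_H
  on the V part, each with exactly the bracket terms that complete a Lie derivative.\<close>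

lemma metric_deriv_ring_connection:
  assumes D: "parallel_metric A D g" and X: "vector_field A X" and Y: "vector_field A Y" and Z: "vector_field A Z"
  shows "metric_deriv A (ring_connection A g H V D) g X Y Z x =
    lie_form x (field_in_chart A (chart_at A x) (pr g V X)) (pr g H Y x) (pr g H Z x) +
    lie_form x (field_in_chart A (chart_at A x) (pr g H X)) (pr g V Y x) (pr g V Z x)"
proof -
  note vf = vector_field_pr[OF X] vector_field_pr[OF Y] vector_field_pr[OF Z]
  have sm: "smooth_fun_on A UNIV (\<lambda>y. g y (pr g H Y y) (pr g H Z y))"
    "smooth_fun_on A UNIV (\<lambda>y. g y (pr g V Y y) (pr g V Z y))"
    using vf smooth_fun_on_metric[OF open_UNIV] by (auto simp: vector_field_def)
  have split: "field_deriv A X f x = field_deriv A (pr g H X) f x + field_deriv A (pr g V X) f x"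
    if "smooth_fun_on A UNIV f" for f
    using that by (rule field_deriv_field_add) (simp add: pr_V_eq)
  have "field_deriv A X (\<lambda>y. g y (Y y) (Z y)) x =
    field_deriv A X (\<lambda>y. g y (pr g H Y y) (pr g H Z y)) x + field_deriv A X (\<lambda>y. g y (pr g V Y y) (pr g V Z y)) x"
    by (subst metric_decompose) (rule field_deriv_add[OF sm])
  moreover have "g x (Y x) (ring_connection A g H V D X Z x) = g x (ring_connection A g H V D X Z x) (Y x)"
    by (rule metricD(2))
  moreover have "field_deriv A (pr g H X) (\<lambda>y. g y (pr g H Y y) (pr g H Z y)) x =
      g x (D (pr g H X) (pr g H Y) x) (pr g H Z x) + g x (pr g H Y x) (D (pr g H X) (pr g H Z) x)"
    "field_deriv A (pr g V X) (\<lambda>y. g y (pr g V Y y) (pr g V Z y)) x =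
      g x (D (pr g V X) (pr g V Y) x) (pr g V Z x) + g x (pr g V Y x) (D (pr g V X) (pr g V Z) x)"
    using D vf unfolding parallel_metric_def metric_deriv_def by (simp_all add: algebra_simps)
  ultimately show ?thesis
    using lie_form_eq[OF vf(2,3,5), of x] lie_form_eq[OF vf(1,4,6), of x]
    unfolding metric_deriv_def split[OF sm(1)] split[OF sm(2)] metric_ring_connection
    by (simp add: metricD(2)[of x "pr g H Y x"] metricD(2)[of x "pr g V Y x"])
qed

text \<open>Mere differentiability at the point accommodates both global smooth fields and the dual
  sections \<open>R \<alpha>\<close>.\<close>

definition section_germ :: "('m \<Rightarrow> 'e set) \<Rightarrow> 'm \<Rightarrow> ('e \<Rightarrow> 'e) \<Rightarrow> bool" where
  "section_germ E x U \<longleftrightarrow> (let c = chart_at A x in U differentiable (at (snd c x)) \<and>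
     (\<forall>\<^sub>F q in nhds (snd c x). coord_field c (U q) (chart_inv c q) \<in> E (chart_inv c q)))"

lemma section_germ_field:
  assumes "vector_field A X" "\<And>y. X y \<in> E y"
  shows "section_germ E x (field_in_chart A (chart_at A x) X)"
  unfolding section_germ_def Let_def
proof
  show "field_in_chart A (chart_at A x) X differentiable (at (snd (chart_at A x) x))"
    using assms(1) by (auto simp: vector_field_def intro: field_in_chart_differentiable)
  show "\<forall>\<^sub>F q in nhds (snd (chart_at A x) x). coord_field (chart_at A x)
      (field_in_chart A (chart_at A x) X q) (chart_inv (chart_at A x) q) \<in> E (chart_inv (chart_at A x) q)"
    by (rule eventually_nhds_chart[OF _ open_UNIV]) (auto simp: assms(2))
qed

lemma section_germ_scale:
  assumes "section_germ E x U" "\<And>y. subspace (E y)"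
  shows "section_germ E x (\<lambda>q. t *\<^sub>R U q)"
  unfolding section_germ_def Let_def
proof
  show "(\<lambda>q. t *\<^sub>R U q) differentiable (at (snd (chart_at A x) x))"
    using assms(1) by (auto simp: section_germ_def Let_def)
  have "\<forall>\<^sub>F q in nhds (snd (chart_at A x) x). coord_field (chart_at A x) (U q) (chart_inv (chart_at A x) q)
      \<in> E (chart_inv (chart_at A x) q)"
    using assms(1) by (auto simp: section_germ_def Let_def)
  then show "\<forall>\<^sub>F q in nhds (snd (chart_at A x) x). coord_field (chart_at A x) (t *\<^sub>R U q) (chart_inv (chart_at A x) q)
      \<in> E (chart_inv (chart_at A x) q)"
    using eventually_chart_inv[OF chart_at_mem(1) open_UNIV UNIV_I chart_at_mem(2), of x]
    by eventually_elim
      (auto simp: linear_cmul[OF linear_coord_field[OF chart_at_mem(1)]] intro: subspace_scale[OF assms(2)])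
qed

lemma section_germ_sharp: "sharp_germ E x R \<Longrightarrow> section_germ E x (R \<alpha>)"
  unfolding section_germ_def sharp_germ_def Let_def is_riesz_def by (auto elim: eventually_mono)

text \<open>Makes a dual section interchangeable with a global field that meets it only at
  \<open>x\<close>. A whole section \<open>Y\<close> of \<open>F\<close> is required, since its
  orthogonality to \<open>U\<close> is differentiated.\<close>

lemma lie_form_cong:
  assumes U: "section_germ E x U" "section_germ E x U'" "U (snd (chart_at A x) x) = U' (snd (chart_at A x) x)"
    and Y: "vector_field A Y" "\<And>y. Y y \<in> F y"
    and o: "\<And>y u w. u \<in> E y \<Longrightarrow> w \<in> F y \<Longrightarrow> g y u w = 0"
  shows "lie_form x U (Y x) (Y x) = lie_form x U' (Y x) (Y x)"
proof -
  define c where "c = chart_at A x"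
  have c: "c \<in> A" "x \<in> fst c" by (simp_all add: c_def)
  interpret metric_germ "chart_metric c" "snd c x"
    using metric_germ_chart_metric[OF c] .
  let ?Y = "field_in_chart A c Y"
  have Y': "?Y differentiable (at (snd c x))"
    using section_germ_field[OF Y] by (simp add: section_germ_def Let_def c_def)
  have "\<forall>\<^sub>F q in nhds (snd c x). chart_metric c q (U q) (?Y q) = 0" if "section_germ E x U" for U
  proof -
    have "\<forall>\<^sub>F q in nhds (snd c x). coord_field c (U q) (chart_inv c q) \<in> E (chart_inv c q)"
      using that by (simp add: section_germ_def Let_def c_def)
    then show ?thesis
      using eventually_chart_inv[OF c(1) open_UNIV UNIV_I c(2)]
      by eventually_elim (use c Y o in \<open>auto simp: chart_metric_def Let_def field_in_chart_def\<close>)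
  qed
  then have "lie_deriv U (?Y (snd c x)) (?Y (snd c x)) = lie_deriv U' (?Y (snd c x)) (?Y (snd c x))"
    using U Y' by (intro lie_deriv_cong) (auto simp: section_germ_def Let_def c_def)
  then show ?thesis by (simp add: c_def)
qed

lemma sharp_germ_center:
  assumes "sharp_germ E x R"
  shows "is_riesz E x (blinfun_apply \<alpha>) (R \<alpha> (snd (chart_at A x) x))"
proof -
  have "\<forall>\<^sub>F q in nhds (snd (chart_at A x) x). \<forall>\<alpha>. is_riesz E (chart_inv (chart_at A x) q)
        (\<lambda>w. blinfun_apply \<alpha> (tangent_coord A (chart_at A x) (chart_inv (chart_at A x) q) w))
        (coord_field (chart_at A x) (R \<alpha> q) (chart_inv (chart_at A x) q))"
    using assms by (simp add: sharp_germ_def Let_def)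
  from eventually_nhds_x_imp_x[OF this] show ?thesis by simp
qed

lemma sharp_germ_energy:
  assumes "sharp_germ E x R"
  shows "\<forall>\<^sub>F q in nhds (snd (chart_at A x) x). chart_metric (chart_at A x) q (R \<alpha> q) (R \<alpha> q) = blinfun_apply \<alpha> (R \<alpha> q)"
proof -
  have "\<forall>\<^sub>F q in nhds (snd (chart_at A x) x). \<forall>\<alpha>. is_riesz E (chart_inv (chart_at A x) q)
        (\<lambda>w. blinfun_apply \<alpha> (tangent_coord A (chart_at A x) (chart_inv (chart_at A x) q) w))
        (coord_field (chart_at A x) (R \<alpha> q) (chart_inv (chart_at A x) q))"
    using assms by (simp add: sharp_germ_def Let_def)
  then show ?thesis
    using eventually_chart_inv[OF chart_at_mem(1) open_UNIV UNIV_I chart_at_mem(2), of x]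
    by eventually_elim (auto simp: is_riesz_def chart_metric_def Let_def tangent_coord_coord_field)
qed

section \<open>The Poisson bracket as a difference of mixed Lie derivatives\<close>

text \<open>The symplectic form on the two Hamiltonian fields is half of \<alpha>(dR S) -
  \<alpha>(dS R), to which \<open>lie_deriv_difference\<close> applies. For the second claim,
  Hamiltonian fields add and the symplectic form vanishes on a repeated argument.\<close>

lemma poisson_brackets:
  assumes h: "\<forall>y. \<forall>u\<in>H y. \<forall>w\<in>H y. h y u w = g y u w"
    and v: "\<forall>y. \<forall>u\<in>V y. \<forall>w\<in>V y. v y u w = g y u w"
    and R: "sharp_germ H x R" and S: "sharp_germ V x S"
  defines "q\<^sub>0 \<equiv> snd (chart_at A x) x"
  shows "2 * poisson_bracket A (hamiltonian H h) (hamiltonian V v) (x, \<alpha>) =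
      lie_form x (R \<alpha>) (S \<alpha> q\<^sub>0) (S \<alpha> q\<^sub>0) - lie_form x (S \<alpha>) (R \<alpha> q\<^sub>0) (R \<alpha> q\<^sub>0)"
    and "poisson_bracket A (hamiltonian H h) (\<lambda>z. hamiltonian H h z + hamiltonian V v z) (x, \<alpha>) =
      poisson_bracket A (hamiltonian H h) (hamiltonian V v) (x, \<alpha>)"
proof -
  define c where "c = chart_at A x"
  have c: "c \<in> A" "x \<in> fst c" and q0: "q\<^sub>0 = snd c x" by (simp_all add: c_def q\<^sub>0_def)
  interpret metric_germ "chart_metric c" q\<^sub>0
    using metric_germ_chart_metric[OF c] by (simp add: q0)
  have dR: "R \<alpha> differentiable (at q\<^sub>0)" and dS: "S \<alpha> differentiable (at q\<^sub>0)"
    using R S by (auto simp: sharp_germ_def Let_def q\<^sub>0_def)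
  \<comment> \<open>The base part of the differential of the Hamiltonian whose dual section is
    \<open>U\<close>.\<close>
  define a where "a = (\<lambda>U. (1/2) *\<^sub>R (\<alpha> o\<^sub>L Blinfun (deriv U)))"
  have a: "blinfun_apply (a U) w = 1/2 * blinfun_apply \<alpha> (deriv U w)" if "U differentiable (at q\<^sub>0)" for U w
    using linear_frechet_derivative[OF that]
    by (simp add: a_def blinfun.scaleR_left bounded_linear_Blinfun_apply linear_conv_bounded_linear)
  let ?F = "hamiltonian H h \<circ> cotangent_chart_inv A c" and ?K = "hamiltonian V v \<circ> cotangent_chart_inv A c"
  have F: "(?F has_derivative (\<lambda>\<eta>. blinfun_apply (a (R \<alpha>)) (fst \<eta>) + blinfun_apply (snd \<eta>) (R \<alpha> q\<^sub>0))) (at (q\<^sub>0, \<alpha>))"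
    using sharp_germ_hamiltonian[OF R subspace_H h[rule_format] ex_is_riesz[OF subbundle_H], of \<alpha>] dR
    by (simp add: a q0 c_def)
  have K: "(?K has_derivative (\<lambda>\<eta>. blinfun_apply (a (S \<alpha>)) (fst \<eta>) + blinfun_apply (snd \<eta>) (S \<alpha> q\<^sub>0))) (at (q\<^sub>0, \<alpha>))"
    using sharp_germ_hamiltonian[OF S subspace_V v[rule_format] ex_is_riesz_V, of \<alpha>] dS
    by (simp add: a q0 c_def)
  have "((\<lambda>z. ?F z + ?K z) has_derivative (\<lambda>\<eta>. blinfun_apply (a (R \<alpha>) + a (S \<alpha>)) (fst \<eta>) +
      blinfun_apply (snd \<eta>) (R \<alpha> q\<^sub>0 + S \<alpha> q\<^sub>0))) (at (q\<^sub>0, \<alpha>))"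
    using has_derivative_add[OF F K] by (simp add: blinfun.bilinear_simps algebra_simps)
  moreover have "(\<lambda>z. ?F z + ?K z) = (\<lambda>z. hamiltonian H h z + hamiltonian V v z) \<circ> cotangent_chart_inv A c"
    by (simp add: fun_eq_iff)
  ultimately have FK: "hamiltonian_vector_field ((\<lambda>z. hamiltonian H h z + hamiltonian V v z) \<circ> cotangent_chart_inv A c) (q\<^sub>0, \<alpha>) =
      (R \<alpha> q\<^sub>0 + S \<alpha> q\<^sub>0, - (a (R \<alpha>) + a (S \<alpha>)))"
    by (intro hamiltonian_vector_field_eq) simp
  have PB: "poisson_bracket A (hamiltonian H h) (hamiltonian V v) (x, \<alpha>) =
      blinfun_apply (a (R \<alpha>)) (S \<alpha> q\<^sub>0) - blinfun_apply (a (S \<alpha>)) (R \<alpha> q\<^sub>0)"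
    unfolding poisson_bracket_def prod.case Let_def c_def[symmetric] q0[symmetric]
      hamiltonian_vector_field_eq[OF F] hamiltonian_vector_field_eq[OF K] canonical_symplectic_eq
    by (simp add: blinfun.minus_left)
  then show "poisson_bracket A (hamiltonian H h) (\<lambda>z. hamiltonian H h z + hamiltonian V v z) (x, \<alpha>) =
      poisson_bracket A (hamiltonian H h) (hamiltonian V v) (x, \<alpha>)"
    unfolding poisson_bracket_def prod.case Let_def c_def[symmetric] q0[symmetric]
      hamiltonian_vector_field_eq[OF F] FK canonical_symplectic_eq
    by (simp add: blinfun.bilinear_simps)
  have m: "chart_metric c q\<^sub>0 u w = g x u w" for u w
    by (simp add: chart_metric_snd[OF c] q0) (simp add: c_def)
  have "blinfun_apply \<alpha> (deriv (R \<alpha>) (S \<alpha> q\<^sub>0)) - blinfun_apply \<alpha> (deriv (S \<alpha>) (R \<alpha> q\<^sub>0)) =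
      lie_deriv (R \<alpha>) (S \<alpha> q\<^sub>0) (S \<alpha> q\<^sub>0) - lie_deriv (S \<alpha>) (R \<alpha> q\<^sub>0) (R \<alpha> q\<^sub>0)"
  proof (rule lie_deriv_difference[OF dR dS])
    show l: "linear (blinfun_apply \<alpha>)"
      by (rule bounded_linear.linear[OF blinfun.bounded_linear_right])
    show "blinfun_apply \<alpha> w = chart_metric c q\<^sub>0 (R \<alpha> q\<^sub>0) w + chart_metric c q\<^sub>0 (S \<alpha> q\<^sub>0) w" for w
      unfolding m using riesz_sum[OF sharp_germ_center[OF R] sharp_germ_center[OF S] l] by (simp add: q\<^sub>0_def)
  qed (use sharp_germ_energy[OF R] sharp_germ_energy[OF S] in \<open>simp_all add: c_def q\<^sub>0_def\<close>)
  then show "2 * poisson_bracket A (hamiltonian H h) (hamiltonian V v) (x, \<alpha>) =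
      lie_form x (R \<alpha>) (S \<alpha> q\<^sub>0) (S \<alpha> q\<^sub>0) - lie_form x (S \<alpha>) (R \<alpha> q\<^sub>0) (R \<alpha> q\<^sub>0)"
    unfolding PB a[OF dR] a[OF dS] by (simp add: c_def q\<^sub>0_def)
qed

text \<open>The covector dual to \<open>t X + Y\<close> turns the vanishing bracket into
  \<open>t (L\<^sub>X g)(Y,Y) = t\<^sup>2 (L\<^sub>Y g)(X,X)\<close> for all \<open>t\<close>.\<close>

lemma lie_form_eq_0_of_poisson:
  assumes h: "\<forall>y. \<forall>u\<in>H y. \<forall>w\<in>H y. h y u w = g y u w"
    and v: "\<forall>y. \<forall>u\<in>V y. \<forall>w\<in>V y. v y u w = g y u w"
    and PB: "\<And>\<alpha>. poisson_bracket A (hamiltonian H h) (hamiltonian V v) (x, \<alpha>) = 0"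
    and X: "vector_field A X" "\<And>y. X y \<in> H y" and Y: "vector_field A Y" "\<And>y. Y y \<in> V y"
  shows "lie_form x (field_in_chart A (chart_at A x) X) (Y x) (Y x) = 0"
    and "lie_form x (field_in_chart A (chart_at A x) Y) (X x) (X x) = 0"
proof -
  obtain R S where R: "sharp_germ H x R" and S: "sharp_germ V x S"
    using ex_sharp_germ_splitting by blast
  define c where "c = chart_at A x"
  have c: "c \<in> A" "x \<in> fst c" by (simp_all add: c_def)
  interpret metric_germ "chart_metric c" "snd c x"
    using metric_germ_chart_metric[OF c] .
  let ?X = "field_in_chart A (chart_at A x) X" and ?Y = "field_in_chart A (chart_at A x) Y"
  have gX: "section_germ H x ?X" and gY: "section_germ V x ?Y"
    using section_germ_field X Y by auto
  have dX: "?X differentiable (at (snd c x))" and dY: "?Y differentiable (at (snd c x))"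
    using gX gY by (auto simp: section_germ_def Let_def c_def)
  have key: "t * lie_form x ?X (Y x) (Y x) = t\<^sup>2 * lie_form x ?Y (X x) (X x)" for t
  proof -
    define \<alpha> where "\<alpha> = Blinfun (g x (t *\<^sub>R X x + Y x))"
    have \<alpha>: "blinfun_apply \<alpha> w = g x (t *\<^sub>R X x + Y x) w" for w
      using metricD(6) by (simp add: \<alpha>_def bounded_linear_Blinfun_apply linear_conv_bounded_linear)
    have "is_riesz H x (blinfun_apply \<alpha>) (t *\<^sub>R X x)"
      using X(2) Y(2) orthogonal subspace_scale[OF subspace_H] by (auto simp: is_riesz_def \<alpha> metric_linear)
    then have R0: "R \<alpha> (snd (chart_at A x) x) = t *\<^sub>R X x"
      using is_riesz_unique[OF subspace_H sharp_germ_center[OF R]] by blast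
    have "is_riesz V x (blinfun_apply \<alpha>) (Y x)"
      using X(2) Y(2) orthogonal by (auto simp: is_riesz_def \<alpha> metric_linear)
    then have S0: "S \<alpha> (snd (chart_at A x) x) = Y x"
      using is_riesz_unique[OF subspace_V sharp_germ_center[OF S]] by blast
    \<comment> \<open>\<open>R \<alpha>\<close> is known only to pass through
      \<open>t *\<^sub>R X x\<close>; locality replaces it by the multiple of the global field,
      whose dependence on \<open>t\<close> is explicit.\<close>
    have "lie_form x (R \<alpha>) (Y x) (Y x) = lie_form x (\<lambda>q. t *\<^sub>R ?X q) (Y x) (Y x)"
      by (rule lie_form_cong[where E = H and F = V])
         (use section_germ_sharp[OF R] section_germ_scale[OF gX subspace_H] R0 Y orthogonal in auto)
    moreover have "lie_form x (\<lambda>q. t *\<^sub>R ?X q) (Y x) (Y x) = t * lie_form x ?X (Y x) (Y x)"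
      using lie_deriv_scale(2)[OF dX] by (simp add: c_def)
    moreover have "lie_form x (S \<alpha>) (X x) (X x) = lie_form x ?Y (X x) (X x)"
      by (rule lie_form_cong[where E = V and F = H])
         (use section_germ_sharp[OF S] gY S0 X orthogonal in auto)
    moreover have "S \<alpha> differentiable (at (snd c x))"
      using S by (simp add: sharp_germ_def Let_def c_def)
    then have "lie_form x (S \<alpha>) (t *\<^sub>R X x) (t *\<^sub>R X x) = t\<^sup>2 * lie_form x (S \<alpha>) (X x) (X x)"
      using lie_deriv_scale(1) by (simp add: c_def)
    ultimately show ?thesis
      using poisson_brackets(1)[where \<alpha> = \<alpha>, OF h v R S] PB[of \<alpha>] R0 S0 by simp
  qed
  \<comment> \<open>With a and b for the two values, t = 1 gives a = b and t = -1 gives -a =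
    b.\<close>
  show "lie_form x ?X (Y x) (Y x) = 0" "lie_form x ?Y (X x) (X x) = 0"
    using key[of 1] key[of "-1"] by simp_all
qed

lemma lie_form_polarize:
  assumes "vector_field A U"
    and "lie_form x (field_in_chart A (chart_at A x) U) y y = 0"
    and "lie_form x (field_in_chart A (chart_at A x) U) z z = 0"
    and "lie_form x (field_in_chart A (chart_at A x) U) (y + z) (y + z) = 0"
  shows "lie_form x (field_in_chart A (chart_at A x) U) y z = 0"
proof -
  interpret metric_germ "chart_metric (chart_at A x)" "snd (chart_at A x) x"
    using metric_germ_chart_metric by simp
  have "field_in_chart A (chart_at A x) U differentiable (at (snd (chart_at A x) x))"
    using assms(1) by (auto simp: vector_field_def intro: field_in_chart_differentiable)
  then show ?thesis
    using lie_deriv_add[of "field_in_chart A (chart_at A x) U" y z] assms(2-) by simp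
qed

text \<open>The bracket controls only the diagonal of each Lie derivative. Since sums of sections
  are again sections, the diagonal vanishes on Y, Z and Y + Z, and polarization gives the mixed
  value.\<close>

lemma parallel_of_poisson:
  assumes h: "\<forall>y. \<forall>u\<in>H y. \<forall>w\<in>H y. h y u w = g y u w"
    and v: "\<forall>y. \<forall>u\<in>V y. \<forall>w\<in>V y. v y u w = g y u w"
    and PB: "\<And>z. poisson_bracket A (hamiltonian H h) (hamiltonian V v) z = 0"
    and D: "parallel_metric A D g"
  shows "parallel_metric A (ring_connection A g H V D) g"
  unfolding parallel_metric_def
proof (intro allI impI, elim conjE)
  fix X Y Z x
  assume X: "vector_field A X" and Y: "vector_field A Y" and Z: "vector_field A Z"
  note vf = vector_field_pr[OF X] vector_field_pr[OF Y] vector_field_pr[OF Z]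
  note z = lie_form_eq_0_of_poisson[OF h v PB]
  have add: "vector_field A (\<lambda>y. P y + Q y)" if "vector_field A P" "vector_field A Q" for P Q
    using that smooth_field_on_add by (auto simp: vector_field_def)
  have "lie_form x (field_in_chart A (chart_at A x) (pr g V X)) (pr g H Y x) (pr g H Z x) = 0"
    using z(2)[OF vf(3) pr_H(1) vf(2) pr_V(1)] z(2)[OF vf(5) pr_H(1) vf(2) pr_V(1)]
      z(2)[OF add[OF vf(3,5)] subspace_add[OF subspace_H pr_H(1) pr_H(1)] vf(2) pr_V(1)]
    by (rule lie_form_polarize[OF vf(2)])
  moreover have "lie_form x (field_in_chart A (chart_at A x) (pr g H X)) (pr g V Y x) (pr g V Z x) = 0"
    using z(1)[OF vf(1) pr_H(1) vf(4) pr_V(1)] z(1)[OF vf(1) pr_H(1) vf(6) pr_V(1)]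
      z(1)[OF vf(1) pr_H(1) add[OF vf(4,6)] subspace_add[OF subspace_V pr_V(1) pr_V(1)]]
    by (rule lie_form_polarize[OF vf(1)])
  ultimately show "metric_deriv A (ring_connection A g H V D) g X Y Z x = 0"
    using metric_deriv_ring_connection[OF D X Y Z] by simp
qed

lemma lie_form_0: "lie_form x U 0 0 = 0"
proof -
  interpret metric_germ "chart_metric (chart_at A x)" "snd (chart_at A x) x"
    using metric_germ_chart_metric by simp
  show ?thesis
    using metric_diff_linear(2)[of _ 0 0 0] center_linear(5)[of 0] center_linear(6)[of _ 0]
    by (simp add: lie_deriv_def)
qed

text \<open>Evaluating the covariant derivative with one field in \<open>H\<close> and the other in
  \<open>V\<close> annihilates one of the two Lie terms, since its projected arguments are zero; so
  each mixed Lie derivative vanishes separately.\<close>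

lemma poisson_of_parallel:
  assumes h: "\<forall>y. \<forall>u\<in>H y. \<forall>w\<in>H y. h y u w = g y u w"
    and v: "\<forall>y. \<forall>u\<in>V y. \<forall>w\<in>V y. v y u w = g y u w"
    and D: "parallel_metric A D g" and ring: "parallel_metric A (ring_connection A g H V D) g"
  shows "poisson_bracket A (hamiltonian H h) (hamiltonian V v) (x, \<alpha>) = 0"
proof -
  obtain R S where R: "sharp_germ H x R" and S: "sharp_germ V x S"
    using ex_sharp_germ_splitting by blast
  define u w where "u = R \<alpha> (snd (chart_at A x) x)" and "w = S \<alpha> (snd (chart_at A x) x)"
  have uw: "u \<in> H x" "w \<in> V x"
    using sharp_germ_center[OF R] sharp_germ_center[OF S] by (auto simp: is_riesz_def u_def w_def)
  obtain X' Y' where "vector_field A X'" "X' x = u" "vector_field A Y'" "Y' x = w"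
    using ex_vector_field by metis
  \<comment> \<open>Projecting the extensions makes them sections of \<open>H\<close> and
    \<open>V\<close> everywhere and keeps their values at \<open>x\<close>, which already lie in
    these subspaces.\<close>
  then obtain X Y where X: "vector_field A X" "\<And>y. X y \<in> H y" "X x = u"
    and Y: "vector_field A Y" "\<And>y. Y y \<in> V y" "Y x = w"
    using vector_field_pr pr_H(1) pr_V(1) pr_H_id pr_V_id uw by metis
  have pX: "pr g H X = X" "pr g V X = (\<lambda>_. 0)"
    using X(2) pr_H_id by (auto simp: pr_V_eq)
  have pY: "pr g V Y = Y" "pr g H Y = (\<lambda>_. 0)"
  proof -
    show "pr g V Y = Y" using Y(2) pr_V_id by auto
    then show "pr g H Y = (\<lambda>_. 0)" by (auto simp: pr_V_eq fun_eq_iff)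
  qed
  have "lie_form x (field_in_chart A (chart_at A x) X) (Y x) (Y x) = 0"
    using metric_deriv_ring_connection[OF D X(1) Y(1) Y(1), of x] ring X(1) Y(1)
    by (simp add: parallel_metric_def pX pY lie_form_0)
  moreover have "lie_form x (field_in_chart A (chart_at A x) Y) (X x) (X x) = 0"
    using metric_deriv_ring_connection[OF D Y(1) X(1) X(1), of x] ring X(1) Y(1)
    by (simp add: parallel_metric_def pX pY lie_form_0)
  moreover have "lie_form x (R \<alpha>) (Y x) (Y x) = lie_form x (field_in_chart A (chart_at A x) X) (Y x) (Y x)"
    by (rule lie_form_cong[where E = H and F = V])
       (use section_germ_sharp[OF R] section_germ_field[OF X(1,2)] X(3) Y orthogonal in \<open>auto simp: u_def\<close>)
  moreover have "lie_form x (S \<alpha>) (X x) (X x) = lie_form x (field_in_chart A (chart_at A x) Y) (X x) (X x)"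
    by (rule lie_form_cong[where E = V and F = H])
       (use section_germ_sharp[OF S] section_germ_field[OF Y(1,2)] X Y(3) orthogonal in \<open>auto simp: w_def\<close>)
  ultimately show ?thesis
    using poisson_brackets(1)[where \<alpha> = \<alpha>, OF h v R S] by (simp add: X(3) Y(3) u_def w_def)
qed

end

theorem lemma2p2:
  fixes A :: "('m::{t2_space,second_countable_topology}, 'e::euclidean_space) chart set"
    and H V :: "'m \<Rightarrow> 'e set"
    and h g v :: "'m \<Rightarrow> 'e \<Rightarrow> 'e \<Rightarrow> real"
    and D :: "('m \<Rightarrow> 'e) \<Rightarrow> ('m \<Rightarrow> 'e) \<Rightarrow> 'm \<Rightarrow> 'e"
    and Hh Hv Hg :: "'m \<times> ('e \<Rightarrow>\<^sub>L real) \<Rightarrow> real"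
  assumes "sub_riemannian_manifold A H h"
    and "riemannian_metric A g"
    and "tames g H h"
    and "V = orth_complement g H"
    and "\<forall>x. \<forall>u\<in>V x. \<forall>w\<in>V x. v x u w = g x u w"
    and "levi_civita_connection A g D"
    and "Hh = hamiltonian H h"
    and "Hv = hamiltonian V v"
    and "Hg = (\<lambda>z. Hh z + Hv z)"
  shows "((\<forall>z. poisson_bracket A Hh Hv z = 0) \<and> (\<forall>z. poisson_bracket A Hh Hg z = 0)) \<longleftrightarrow>
    parallel_metric A (ring_connection A g H V D) g"
proof -
  interpret riemannian_splitting A g H V
    using assms(1,2,4) by unfold_locales (auto simp: sub_riemannian_manifold_def)
  have h: "\<forall>y. \<forall>u\<in>H y. \<forall>w\<in>H y. h y u w = g y u w"
    using assms(3) by (simp add: tames_def)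
  note v = assms(5)
  have D: "parallel_metric A D g"
    using assms(6) by (simp add: levi_civita_connection_def)
  have Hg: "poisson_bracket A Hh Hg z = poisson_bracket A Hh Hv z" for z
  proof (cases z)
    case (Pair x \<alpha>)
    obtain R S where "sharp_germ H x R" "sharp_germ V x S"
      using ex_sharp_germ_splitting by blast
    then show ?thesis
      using poisson_brackets(2)[OF h v] Pair by (simp add: assms(7-9))
  qed
  show ?thesis
  proof
    assume "(\<forall>z. poisson_bracket A Hh Hv z = 0) \<and> (\<forall>z. poisson_bracket A Hh Hg z = 0)"
    then show "parallel_metric A (ring_connection A g H V D) g"
      unfolding assms(7,8) by (intro parallel_of_poisson[OF h v _ D]) blast
  next
    assume "parallel_metric A (ring_connection A g H V D) g"
    then have "poisson_bracket A Hh Hv z = 0" for z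
      using poisson_of_parallel[OF h v D] by (cases z) (simp add: assms(7,8))
    then show "(\<forall>z. poisson_bracket A Hh Hv z = 0) \<and> (\<forall>z. poisson_bracket A Hh Hg z = 0)"
      by (simp add: Hg)
  qed
qed

end
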